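(* Let $\mathfrak{H}$ be a complex Hilbert space (finite or infinite dimensional). Let $f$ and $g$ be positive, strictly increasing, concave functions that are $C^2$ on $(0,\infty)$ and continuous on $[0,\infty)$. Let $X,Y\in B(\mathfrak{H})$ be positive operators. If $$\langle (g\circ f)(X)\xi,\xi\rangle\leq g(\langle f(Y)\xi,\xi\rangle)\leq (g\circ f)(\langle X\xi,\xi\rangle)$$ for every unit vector $\xi\in\mathfrak{H}$, then $X=Y$.
   Context: $B(\mathfrak{H})$ denotes the bounded linear operators on $\mathfrak{H}$, and $\langle\cdot,\cdot\rangle$ its inner product. A positive operator $A$ is one with $\langle A\xi,\xi\rangle\ge 0$ for all $\xi$ (not necessarily invertible). Functions of positive operators are defined by the continuous functional calculus. "Positive" for $f,g$ refers to their being positive on $(0,\infty)$; with continuity on $[0,\infty)$ the values $f(0),g(0)$ are $\ge 0$ and may equal $0$ (e.g. $f(t)=g(t)=\sqrt{t}$ is allowed). *)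

theory Defs
  imports "HOL-Analysis.Analysis"
begin

section \<open>Complex Hilbert spaces\<close>

class complex_vector = real_vector +
  fixes scaleC :: "complex \<Rightarrow> 'a \<Rightarrow> 'a"  (infixr "*\<^sub>C" 75)
  assumes scaleC_add_right: "c *\<^sub>C (x + y) = c *\<^sub>C x + c *\<^sub>C y"
    and scaleC_add_left: "(c + d) *\<^sub>C x = c *\<^sub>C x + d *\<^sub>C x"
    and scaleC_scaleC: "c *\<^sub>C (d *\<^sub>C x) = (c * d) *\<^sub>C x"
    and scaleC_one: "1 *\<^sub>C x = x"
    and scaleR_scaleC: "r *\<^sub>R x = complex_of_real r *\<^sub>C x"

text \<open>The complex inner product is linear in its first argument.  Its positive definiteness and
  the identity \<open>norm x = sqrt (Re (cinner x x))\<close> come from \<^class>\<open>real_inner\<close>, whose inner product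
  is required to be the real part of the complex one.\<close>

class complex_inner = complex_vector + real_inner +
  fixes cinner :: "'a \<Rightarrow> 'a \<Rightarrow> complex"
  assumes cinner_add_left: "cinner (x + y) z = cinner x z + cinner y z"
    and cinner_scaleC_left: "cinner (c *\<^sub>C x) y = c * cinner x y"
    and cinner_commute: "cinner x y = cnj (cinner y x)"
    and inner_eq_Re_cinner: "inner x y = Re (cinner x y)"

class complex_hilbert_space = complex_inner + complete_space


section \<open>Bounded operators\<close>

text \<open>The type \<open>'a \<Rightarrow>\<^sub>L 'a\<close> consists of the bounded real-linear maps, so that membership in
  \<open>B(H)\<close> additionally requires complex homogeneity.\<close>

definition complex_operator :: "('a::complex_hilbert_space \<Rightarrow>\<^sub>L 'a) \<Rightarrow> bool" where
  "complex_operator A \<longleftrightarrow> (\<forall>c x. blinfun_apply A (c *\<^sub>C x) = c *\<^sub>C blinfun_apply A x)"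

definition positive_operator :: "('a::complex_hilbert_space \<Rightarrow>\<^sub>L 'a) \<Rightarrow> bool" where
  "positive_operator A \<longleftrightarrow> complex_operator A \<and>
     (\<forall>\<xi>. cinner (blinfun_apply A \<xi>) \<xi> \<in> \<real> \<and> 0 \<le> Re (cinner (blinfun_apply A \<xi>) \<xi>))"

definition spectrum :: "('a::complex_hilbert_space \<Rightarrow>\<^sub>L 'a) \<Rightarrow> complex set" where
  "spectrum A = {z. \<not> (\<exists>B. complex_operator B \<and>
     (\<forall>x. blinfun_apply B (blinfun_apply A x - z *\<^sub>C x) = x) \<and>
     (\<forall>x. blinfun_apply A (blinfun_apply B x) - z *\<^sub>C blinfun_apply B x = x))}"


section \<open>Continuous functional calculus\<close>

text \<open>\<open>\<Phi>\<close> is a contractive unital *-homomorphism from the continuous functions on the spectrum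
  of \<open>A\<close> into \<open>B(H)\<close> that sends the identity function to \<open>A\<close>.  Contractivity makes \<open>\<Phi> h\<close> depend
  only on the restriction of \<open>h\<close> to the spectrum.\<close>

definition functional_calculus ::
    "('a::complex_hilbert_space \<Rightarrow>\<^sub>L 'a) \<Rightarrow> ((complex \<Rightarrow> complex) \<Rightarrow> ('a \<Rightarrow>\<^sub>L 'a)) \<Rightarrow> bool" where
  "functional_calculus A \<Phi> \<longleftrightarrow>
     \<Phi> (\<lambda>z. 1) = id_blinfun \<and> \<Phi> (\<lambda>z. z) = A \<and>
     (\<forall>h. continuous_on (spectrum A) h \<longrightarrow>
        complex_operator (\<Phi> h) \<and>
        (\<forall>c x. blinfun_apply (\<Phi> (\<lambda>z. c * h z)) x = c *\<^sub>C blinfun_apply (\<Phi> h) x) \<and>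
        (\<forall>x y. cinner (blinfun_apply (\<Phi> (\<lambda>z. cnj (h z))) x) y
                 = cinner x (blinfun_apply (\<Phi> h) y)) \<and>
        (\<forall>M\<ge>0. (\<forall>z\<in>spectrum A. cmod (h z) \<le> M) \<longrightarrow> norm (\<Phi> h) \<le> M)) \<and>
     (\<forall>h k. continuous_on (spectrum A) h \<and> continuous_on (spectrum A) k \<longrightarrow>
        \<Phi> (\<lambda>z. h z + k z) = \<Phi> h + \<Phi> k \<and>
        \<Phi> (\<lambda>z. h z * k z) = \<Phi> h o\<^sub>L \<Phi> k)"

text \<open>The operator \<open>f(A)\<close> for positive \<open>A\<close> and \<open>f\<close> continuous on \<open>[0,\<infinity>)\<close>.  The spectrum of \<open>A\<close> is
  then a compact subset of \<open>[0,\<infinity>)\<close>, so \<open>\<lambda>z. of_real (f (Re z))\<close> represents \<open>f\<close> on it, and the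
  operator described is unique by the Weierstrass approximation theorem.\<close>

definition op_fun ::
    "(real \<Rightarrow> real) \<Rightarrow> ('a::complex_hilbert_space \<Rightarrow>\<^sub>L 'a) \<Rightarrow> ('a \<Rightarrow>\<^sub>L 'a)" where
  "op_fun f A = (THE T. \<exists>\<Phi>. functional_calculus A \<Phi> \<and> T = \<Phi> (\<lambda>z. complex_of_real (f (Re z))))"


section \<open>Twice continuously differentiable functions\<close>

definition C2_on :: "real set \<Rightarrow> (real \<Rightarrow> real) \<Rightarrow> bool" where
  "C2_on S f \<longleftrightarrow> (\<exists>f' f''.
     (\<forall>t\<in>S. (f has_real_derivative f' t) (at t within S)) \<and>
     (\<forall>t\<in>S. (f' has_real_derivative f'' t) (at t within S)) \<and>
     continuous_on S f'')"

end

theory Submission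
  imports Defs "HOL-Computational_Algebra.Fundamental_Theorem_Algebra"
begin

text \<open>
  Put \<open>Z = f(Y)\<close>.  As \<open>g\<close> is strictly increasing, the hypotheses say that for unit vectors
  \<open>\<langle>(g \<circ> f)(X) \<xi>, \<xi>\<rangle> \<le> g \<langle>Z \<xi>, \<xi>\<rangle>\<close> and \<open>\<langle>Z \<xi>, \<xi>\<rangle> \<le> f \<langle>X \<xi>, \<xi>\<rangle>\<close>.  The point is to conclude
  \<open>Z = f(X)\<close>; then \<open>f(X) = f(Y)\<close>, and \<open>X = Y\<close> because \<open>f\<close> is injective (\<open>op_fun_inj\<close>).

  Suppose first that \<open>\<xi>\<close> is a unit eigenvector of \<open>X\<close> with eigenvalue \<open>x > 0\<close>.  Both ends of the
  inequalities agree at \<open>\<xi>\<close>, so \<open>\<langle>Z \<xi>, \<xi>\<rangle> = f x\<close>.  Since \<open>f\<close> lies below its tangent at \<open>x\<close>, the upper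
  inequality makes \<open>P = f x + f' x (X - x) - Z\<close> a positive operator, and \<open>\<langle>P \<xi>, \<xi>\<rangle> = 0\<close>.  Hence
  \<open>P \<xi> = 0\<close>, that is, \<open>Z \<xi> = f x \<xi> = f(X) \<xi>\<close>.

  In general there are no eigenvectors, and the argument is made quantitative.  If \<open>\<xi>\<close> has mean
  \<open>x = \<langle>X \<xi>, \<xi>\<rangle>\<close> and variance \<open>v\<^sup>2 = \<parallel>(X - x) \<xi>\<parallel>\<^sup>2\<close>, the \<open>C\<^sup>2\<close> hypothesis bounds \<open>\<langle>P \<xi>, \<xi>\<rangle>\<close> by a
  multiple of \<open>v\<^sup>2\<close>, so that \<open>\<parallel>(Z - f(X)) \<xi>\<parallel> \<le> C v\<close> (\<open>deviation_bound\<close>).  A vector splits into \<open>n\<close>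
  almost orthogonal pieces with \<open>v\<close> of relative size \<open>1 / n\<close>; adding the estimates yields an error of
  order \<open>sqrt n / n\<close>, which tends to \<open>0\<close> (\<open>deviation_zero_above\<close>).  All this is uniform only away
  from the point \<open>0\<close> of the spectrum, where the derivatives of \<open>f\<close> and \<open>g\<close> may be unbounded.  It gives
  \<open>(Z - f(X)) X = 0\<close>, and the kernel of \<open>X\<close> is treated by \<open>Z \<ge> f 0\<close> (\<open>operator_eq_op_fun\<close>).

  The functional calculus is constructed for positive operators.  The spectrum consists of
  approximate eigenvalues (\<open>spectrum_positive_operator\<close>), polynomials satisfy
  \<open>\<parallel>p(A)\<parallel> \<le> sup \<bar>p\<bar>\<close> over the spectrum (\<open>norm_poly_op_le\<close>), and uniform limits of polynomials give
  existence and uniqueness (\<open>functional_calculus_exists\<close>, \<open>functional_calculus_poly_limit\<close>).\<close>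

section \<open>The complex inner product\<close>

instance complex_hilbert_space \<subseteq> banach ..

lemma scaleC_zero_right [simp]: "c *\<^sub>C (0::'a::complex_vector) = 0"
  using scaleC_add_right [of c "0::'a" 0] by simp

lemma scaleC_zero_left [simp]: "0 *\<^sub>C (x::'a::complex_vector) = 0"
  using scaleC_add_left [of 0 0 x] by simp

lemma scaleC_minus_left: "(- c) *\<^sub>C (x::'a::complex_vector) = - (c *\<^sub>C x)"
  using scaleC_add_left [of c "- c" x] by (simp add: eq_neg_iff_add_eq_0 add.commute)

lemma scaleC_minus_right: "c *\<^sub>C (- x::'a::complex_vector) = - (c *\<^sub>C x)"
  using scaleC_add_right [of c x "- x"] by (simp add: eq_neg_iff_add_eq_0 add.commute)

lemma scaleC_diff_right: "c *\<^sub>C (x - y::'a::complex_vector) = c *\<^sub>C x - c *\<^sub>C y"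
  using scaleC_add_right [of c x "- y"] by (simp add: scaleC_minus_right)

lemma scaleC_diff_left: "(c - d) *\<^sub>C (x::'a::complex_vector) = c *\<^sub>C x - d *\<^sub>C x"
  using scaleC_add_left [of c "- d" x] by (simp add: scaleC_minus_left)

lemma cinner_add_right: "cinner x (y + z) = cinner x y + cinner x (z::'a::complex_inner)"
  by (metis cinner_add_left cinner_commute complex_cnj_add)

lemma cinner_scaleC_right: "cinner x (c *\<^sub>C y) = cnj c * cinner x (y::'a::complex_inner)"
  by (metis cinner_commute cinner_scaleC_left complex_cnj_mult)

lemma cinner_minus_left: "cinner (- x) y = - cinner x (y::'a::complex_inner)"
  using cinner_scaleC_left [of "-1" x y] by (simp add: scaleC_minus_left scaleC_one)

lemma cinner_minus_right: "cinner x (- y) = - cinner x (y::'a::complex_inner)"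
  using cinner_scaleC_right [of x "-1" y] by (simp add: scaleC_minus_left scaleC_one)

lemma cinner_diff_left: "cinner (x - y) z = cinner x z - cinner y (z::'a::complex_inner)"
  using cinner_add_left [of x "- y" z] by (simp add: cinner_minus_left)

lemma cinner_diff_right: "cinner x (y - z) = cinner x y - cinner x (z::'a::complex_inner)"
  using cinner_add_right [of x y "- z"] by (simp add: cinner_minus_right)

lemma cinner_zero_left [simp]: "cinner 0 (x::'a::complex_inner) = 0"
  using cinner_diff_left [of 0 0 x] by simp

lemma cinner_zero_right [simp]: "cinner (x::'a::complex_inner) 0 = 0"
  using cinner_diff_right [of x 0 0] by simp

lemmas cinner_simps = cinner_add_left cinner_add_right cinner_diff_left cinner_diff_right
  cinner_scaleC_left cinner_scaleC_right cinner_minus_left cinner_minus_right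

lemma norm_scaleC: "norm (c *\<^sub>C x) = cmod c * norm (x::'a::complex_inner)"
proof -
  have "(norm (c *\<^sub>C x))\<^sup>2 = Re (c * (cnj c * cinner x x))"
    by (simp only: power2_norm_eq_inner inner_eq_Re_cinner cinner_simps mult.left_commute)
  also have "c * (cnj c * cinner x x) = complex_of_real ((cmod c)\<^sup>2) * cinner x x"
    by (simp only: complex_norm_square mult.assoc)
  also have "Re \<dots> = (cmod c)\<^sup>2 * Re (cinner x x)"
    by (simp only: times_complex.sel complex.sel Re_complex_of_real Im_complex_of_real)
  also have "\<dots> = (cmod c * norm x)\<^sup>2"
    by (simp only: power_mult_distrib power2_norm_eq_inner [of x] inner_eq_Re_cinner)
  finally show ?thesis by simp
qed

lemma bounded_linear_scaleC: "bounded_linear (\<lambda>x::'a::complex_inner. c *\<^sub>C x)"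
  by (rule bounded_linear_intro [where K = "cmod c"])
    (simp_all add: scaleC_add_right scaleR_scaleC scaleC_scaleC mult.commute norm_scaleC)

text \<open>Complex polarization: the form \<open>q x y = \<langle>A x, y\<rangle> - \<langle>x, A y\<rangle>\<close> vanishes on the diagonal,
  and its values at \<open>x + y\<close> and \<open>x + \<i> y\<close> then force \<open>q y x = - q x y\<close> and \<open>q y x = q x y\<close>.\<close>

lemma positive_operator_cinner_symmetric:
  assumes "positive_operator A"
  shows "cinner (blinfun_apply A x) y = cinner x (blinfun_apply A y)"
proof -
  define q where "q x y = cinner (blinfun_apply A x) y - cinner x (blinfun_apply A y)" for x y
  have hom: "blinfun_apply A (c *\<^sub>C x) = c *\<^sub>C blinfun_apply A x" for c x
    using assms by (simp add: positive_operator_def complex_operator_def)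
  have "q x x = 0" for x
  proof -
    have "cinner (blinfun_apply A x) x \<in> \<real>"
      using assms by (simp add: positive_operator_def)
    then show ?thesis
      unfolding q_def by (metis cinner_commute Reals_cnj_iff right_minus_eq)
  qed
  then have "q (x + y) (x + y) = 0" "q (x + \<i> *\<^sub>C y) (x + \<i> *\<^sub>C y) = 0" "q x x = 0" "q y y = 0"
    by blast+
  then have "q x y + q y x = 0" "\<i> * (q y x - q x y) = 0"
    unfolding q_def by (simp_all add: cinner_simps blinfun.add_right hom algebra_simps)
  then have "q x y = 0" by simp
  then show ?thesis by (simp add: q_def)
qed

lemma positive_operator_symmetric:
  "positive_operator A \<Longrightarrow> inner (blinfun_apply A x) y = inner x (blinfun_apply A y)"
  by (simp add: inner_eq_Re_cinner positive_operator_cinner_symmetric)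

lemma positive_operator_inner_nonneg:
  "positive_operator A \<Longrightarrow> 0 \<le> inner (blinfun_apply A x) x"
  by (simp add: inner_eq_Re_cinner positive_operator_def)

section \<open>The spectrum of a positive operator\<close>

text \<open>For small \<open>t > 0\<close> the map \<open>x \<mapsto> x - t (P x - y)\<close> is a contraction, because coercivity gives
  \<open>\<parallel>x - t P x\<parallel>\<^sup>2 \<le> (1 - 2 t k + t\<^sup>2 M\<^sup>2) \<parallel>x\<parallel>\<^sup>2\<close> when \<open>M\<close> bounds \<open>P\<close>.  Its fixed point solves
  \<open>P x = y\<close>.  This replaces the projection theorem in the study of the spectrum.\<close>

lemma coercive_operator_surj:
  fixes P :: "'a::{real_inner, complete_space} \<Rightarrow>\<^sub>L 'a"
  assumes k: "k > 0" and coercive: "\<And>x. k * (norm x)\<^sup>2 \<le> inner (blinfun_apply P x) x"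
  shows "\<exists>x. blinfun_apply P x = y"
proof -
  \<comment> \<open>Adding \<open>k\<close> to the norm makes \<open>M\<close> positive and
    \<open>k / M \<le> 1\<close>; the choice \<open>t = k / M\<^sup>2\<close> minimizes the
    contraction factor.\<close>
  define M where "M = norm P + k"
  have M: "M > 0" using k by (simp add: M_def add_nonneg_pos)
  have "k \<le> M" by (simp add: M_def)
  define t where "t = k / M\<^sup>2"
  define c where "c = sqrt (1 - (k / M)\<^sup>2)"
  have t: "t > 0" using k M by (simp add: t_def)
  have kM: "0 < (k / M)\<^sup>2" "(k / M)\<^sup>2 \<le> 1"
    using k M \<open>k \<le> M\<close> by (simp_all add: power_le_one)
  have c: "0 \<le> c" "c < 1"
    using kM by (auto simp: c_def intro: order.strict_trans2)
  have contr: "norm (x - t *\<^sub>R blinfun_apply P x) \<le> c * norm x" for x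
  proof (rule power2_le_imp_le)
    have "norm (blinfun_apply P x) \<le> M * norm x"
      using norm_blinfun [of P x] k
      by (smt (verit) M_def mult_right_mono norm_ge_zero)
    then have "(norm (blinfun_apply P x))\<^sup>2 \<le> M\<^sup>2 * (norm x)\<^sup>2"
      by (metis norm_ge_zero power_mono power_mult_distrib)
    then have 1: "t\<^sup>2 * (norm (blinfun_apply P x))\<^sup>2 \<le> t\<^sup>2 * (M\<^sup>2 * (norm x)\<^sup>2)"
      by (intro mult_left_mono) auto
    have 2: "2 * t * (k * (norm x)\<^sup>2) \<le> 2 * t * inner (blinfun_apply P x) x"
      using coercive t by (intro mult_left_mono) auto
    have "(norm (x - t *\<^sub>R blinfun_apply P x))\<^sup>2
        = (norm x)\<^sup>2 - 2 * t * inner (blinfun_apply P x) x + t\<^sup>2 * (norm (blinfun_apply P x))\<^sup>2"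
      unfolding power2_norm_eq_inner
      by (simp add: inner_diff_left inner_diff_right inner_commute [of x "blinfun_apply P x"]
          power2_eq_square algebra_simps)
    also have "\<dots> \<le> (norm x)\<^sup>2 - 2 * t * (k * (norm x)\<^sup>2) + t\<^sup>2 * (M\<^sup>2 * (norm x)\<^sup>2)"
      using 1 2 by linarith
    also have "\<dots> = (1 - (k / M)\<^sup>2) * (norm x)\<^sup>2"
      using M by (simp add: t_def field_simps power2_eq_square)
    also have "\<dots> = (c * norm x)\<^sup>2"
      using kM by (simp add: c_def power_mult_distrib)
    finally show "(norm (x - t *\<^sub>R blinfun_apply P x))\<^sup>2 \<le> (c * norm x)\<^sup>2" .
  qed (use c in simp)
  have "\<exists>!x. x - t *\<^sub>R (blinfun_apply P x - y) = x"
  proof -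
    have "dist (x - t *\<^sub>R (blinfun_apply P x - y)) (z - t *\<^sub>R (blinfun_apply P z - y)) \<le> c * dist x z"
      for x z
    proof -
      have "dist (x - t *\<^sub>R (blinfun_apply P x - y)) (z - t *\<^sub>R (blinfun_apply P z - y))
          = norm ((x - z) - t *\<^sub>R blinfun_apply P (x - z))"
        by (simp add: dist_norm blinfun.diff_right algebra_simps)
      then show ?thesis using contr [of "x - z"] by (simp add: dist_norm)
    qed
    with Banach_fix [OF complete_UNIV UNIV_not_empty c,
        of "\<lambda>x. x - t *\<^sub>R (blinfun_apply P x - y)"]
    show ?thesis by auto
  qed
  then obtain x where "x - t *\<^sub>R (blinfun_apply P x - y) = x" by blast
  with t show ?thesis by auto
qed

definition bounded_below_at :: "('a::complex_hilbert_space \<Rightarrow>\<^sub>L 'a) \<Rightarrow> complex \<Rightarrow> bool" where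
  "bounded_below_at A z \<longleftrightarrow> (\<exists>c>0. \<forall>x. c * norm x \<le> norm (blinfun_apply A x - z *\<^sub>C x))"

text \<open>The vectors \<open>A x - (Re z) x\<close> and \<open>\<i> (Im z) x\<close> are orthogonal for the real inner product,
  because \<open>\<langle>(A - Re z) x, x\<rangle>\<close> is real.  In particular the norm is the same for \<open>z\<close> and its
  conjugate, which is the normality of \<open>A - z\<close>.\<close>

lemma norm_symmetric_diff_scaleC:
  fixes A :: "'a::complex_hilbert_space \<Rightarrow>\<^sub>L 'a"
  assumes "positive_operator A"
  shows "(norm (blinfun_apply A x - z *\<^sub>C x))\<^sup>2
    = (norm (blinfun_apply A x - Re z *\<^sub>R x))\<^sup>2 + (Im z)\<^sup>2 * (norm x)\<^sup>2"
proof -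
  let ?y = "blinfun_apply A x - Re z *\<^sub>R x"
  have "z = of_real (Re z) + \<i> * of_real (Im z)" by (simp add: complex_eq_iff)
  then have eq: "blinfun_apply A x - z *\<^sub>C x = ?y - \<i> *\<^sub>C (Im z *\<^sub>R x)"
    by (metis diff_diff_eq scaleC_add_left scaleC_scaleC scaleR_scaleC)
  have "cinner ?y x = cinner x ?y"
    using assms by (simp add: positive_operator_cinner_symmetric scaleR_scaleC cinner_simps)
  then have "cinner ?y x \<in> \<real>"
    by (metis Reals_cnj_iff cinner_commute)
  then have "inner ?y (\<i> *\<^sub>C (Im z *\<^sub>R x)) = 0"
    by (auto simp: inner_eq_Re_cinner cinner_scaleC_right scaleR_scaleC complex_is_Real_iff)
  then have "(norm (?y - \<i> *\<^sub>C (Im z *\<^sub>R x)))\<^sup>2 = (norm ?y)\<^sup>2 + (norm (\<i> *\<^sub>C (Im z *\<^sub>R x)))\<^sup>2"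
    by (simp add: power2_norm_eq_inner inner_diff_left inner_diff_right inner_commute)
  then show ?thesis
    by (simp add: eq norm_scaleC power_mult_distrib)
qed

text \<open>If \<open>N = A - z\<close> is bounded below, then \<open>N\<^sup>* N\<close> is coercive and hence surjective; as \<open>N\<^sup>*\<close>
  commutes with \<open>N\<close>, also \<open>N\<close> is surjective, and the lower bound makes the inverse bounded.  So the
  spectrum consists of approximate eigenvalues, which is the form in which it is used below.\<close>

lemma spectrum_positive_operator:
  fixes A :: "'a::complex_hilbert_space \<Rightarrow>\<^sub>L 'a"
  assumes A: "positive_operator A"
  shows "spectrum A = {z. \<not> bounded_below_at A z}"
proof (intro set_eqI iffI; rule ccontr)
  fix z assume z: "z \<in> {z. \<not> bounded_below_at A z}" and "z \<notin> spectrum A"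
  then obtain B where B: "\<And>x. blinfun_apply B (blinfun_apply A x - z *\<^sub>C x) = x"
    by (auto simp: spectrum_def)
  have "1 / (norm B + 1) * norm x \<le> norm (blinfun_apply A x - z *\<^sub>C x)" for x
  proof -
    have "norm x \<le> norm B * norm (blinfun_apply A x - z *\<^sub>C x)"
      using norm_blinfun [of B "blinfun_apply A x - z *\<^sub>C x"] B by simp
    also have "\<dots> \<le> (norm B + 1) * norm (blinfun_apply A x - z *\<^sub>C x)"
      by (simp add: algebra_simps)
    finally show ?thesis
      by (simp add: divide_simps add_nonneg_pos mult.commute)
  qed
  moreover have "1 / (norm B + 1) > 0" by (simp add: add_nonneg_pos)
  ultimately show False using z unfolding bounded_below_at_def by blast
next
  fix z assume "z \<in> spectrum A" and "z \<notin> {z. \<not> bounded_below_at A z}"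
  then obtain c where c: "c > 0"
    and below: "\<And>x. c * norm x \<le> norm (blinfun_apply A x - z *\<^sub>C x)"
    by (auto simp: bounded_below_at_def)
  define N where "N = A - Blinfun (\<lambda>x. z *\<^sub>C x)"
  define N' where "N' = A - Blinfun (\<lambda>x. cnj z *\<^sub>C x)"
  have N: "blinfun_apply N x = blinfun_apply A x - z *\<^sub>C x"
    and N': "blinfun_apply N' x = blinfun_apply A x - cnj z *\<^sub>C x" for x
    by (simp_all add: N_def N'_def blinfun.diff_left bounded_linear_Blinfun_apply
        bounded_linear_scaleC)
  have hom: "blinfun_apply A (c *\<^sub>C x) = c *\<^sub>C blinfun_apply A x" for c x
    using A by (simp add: positive_operator_def complex_operator_def)
  have adj: "inner (blinfun_apply N' x) y = inner x (blinfun_apply N y)" for x y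
    using A by (simp add: N N' inner_eq_Re_cinner cinner_simps positive_operator_cinner_symmetric)
  have commute: "blinfun_apply N' (blinfun_apply N x) = blinfun_apply N (blinfun_apply N' x)" for x
    by (simp add: N N' blinfun.diff_right hom scaleC_diff_right scaleC_scaleC mult.commute)
  have surj: "\<exists>x. blinfun_apply N x = y" for y
  proof -
    have "c\<^sup>2 * (norm x)\<^sup>2 \<le> inner (blinfun_apply (N' o\<^sub>L N) x) x" for x
    proof -
      have "inner (blinfun_apply (N' o\<^sub>L N) x) x = (norm (blinfun_apply N x))\<^sup>2"
        by (simp add: adj power2_norm_eq_inner)
      moreover have "(c * norm x)\<^sup>2 \<le> (norm (blinfun_apply N x))\<^sup>2"
        using below [of x] c by (intro power_mono) (auto simp: N)
      ultimately show ?thesis by (simp add: power_mult_distrib)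
    qed
    then obtain x where "blinfun_apply (N' o\<^sub>L N) x = y"
      using coercive_operator_surj [of "c\<^sup>2" "N' o\<^sub>L N" y] c by auto
    then show ?thesis by (metis blinfun_apply_blinfun_compose commute)
  qed
  have inj: "x = y" if "blinfun_apply N x = blinfun_apply N y" for x y
  proof -
    have "c * norm (x - y) \<le> norm (blinfun_apply N (x - y))" using below by (simp add: N)
    also have "\<dots> = 0" using that by (simp add: blinfun.diff_right)
    finally show ?thesis using c by (simp add: mult_le_0_iff)
  qed
  define b where "b = inv (blinfun_apply N)"
  have b: "blinfun_apply N (b y) = y" for y
    unfolding b_def using surj by (intro f_inv_into_f) (metis rangeI)
  have b': "b (blinfun_apply N x) = x" for x using b inj by blast
  have hom_N: "blinfun_apply N (c *\<^sub>C x) = c *\<^sub>C blinfun_apply N x" for c x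
    by (simp add: N hom scaleC_diff_right scaleC_scaleC mult.commute)
  have hom_b: "b (c *\<^sub>C y) = c *\<^sub>C b y" for c y
    by (rule inj) (simp add: b hom_N)
  have "bounded_linear b"
  proof (rule bounded_linear_intro [where K = "1 / c"])
    show "b (x + y) = b x + b y" for x y by (rule inj) (simp add: b blinfun.add_right)
    show "b (r *\<^sub>R x) = r *\<^sub>R b x" for r x by (rule inj) (simp add: b blinfun.scaleR_right)
    show "norm (b x) \<le> norm x * (1 / c)" for x
      using below [of "b x"] c b [of x] by (simp add: N field_simps)
  qed
  then have "blinfun_apply (Blinfun b) = b" by (rule bounded_linear_Blinfun_apply)
  then have "z \<notin> spectrum A"
    unfolding spectrum_def complex_operator_def mem_Collect_eq not_not
    by (intro exI [where x = "Blinfun b"]) (simp add: hom_b b b' flip: N)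
  with \<open>z \<in> spectrum A\<close> show False by blast
qed

lemma spectrum_positive_operator_subset:
  fixes A :: "'a::complex_hilbert_space \<Rightarrow>\<^sub>L 'a"
  assumes A: "positive_operator A"
  shows "spectrum A \<subseteq> complex_of_real ` {0..norm A}"
proof
  fix z assume "z \<in> spectrum A"
  then have z: "\<not> bounded_below_at A z" using A by (simp add: spectrum_positive_operator)
  have norm_eq: "(norm (blinfun_apply A x - z *\<^sub>C x))\<^sup>2
    = (norm (blinfun_apply A x - Re z *\<^sub>R x))\<^sup>2 + (Im z)\<^sup>2 * (norm x)\<^sup>2" for x
    by (rule norm_symmetric_diff_scaleC [OF A])
  have ge: "norm (blinfun_apply A x - Re z *\<^sub>R x) \<le> norm (blinfun_apply A x - z *\<^sub>C x)" for x
    by (rule power2_le_imp_le) (auto simp: norm_eq)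
  have "Im z = 0"
  proof (rule ccontr)
    assume "Im z \<noteq> 0"
    moreover have "\<bar>Im z\<bar> * norm x \<le> norm (blinfun_apply A x - z *\<^sub>C x)" for x
      by (rule power2_le_imp_le) (auto simp: norm_eq power_mult_distrib)
    ultimately show False using z unfolding bounded_below_at_def
      by (metis zero_less_abs_iff)
  qed
  moreover have "Re z \<ge> 0"
  proof (rule ccontr)
    assume neg: "\<not> Re z \<ge> 0"
    have "- Re z * norm x \<le> norm (blinfun_apply A x - z *\<^sub>C x)" for x
    proof (cases "x = 0")
      case False
      have "- Re z * norm x * norm x \<le> inner (blinfun_apply A x - Re z *\<^sub>R x) x"
        using positive_operator_inner_nonneg [OF A, of x]
        by (simp add: inner_diff_left dot_square_norm power2_eq_square)
      also have "\<dots> \<le> norm (blinfun_apply A x - Re z *\<^sub>R x) * norm x"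
        by (rule norm_cauchy_schwarz)
      also have "\<dots> \<le> norm (blinfun_apply A x - z *\<^sub>C x) * norm x"
        using ge by (intro mult_right_mono) auto
      finally show ?thesis by (rule mult_right_le_imp_le) (use False in simp)
    qed auto
    with neg z show False unfolding bounded_below_at_def by (meson neg_0_less_iff_less not_le)
  qed
  moreover have "Re z \<le> norm A"
  proof (rule ccontr)
    assume gt: "\<not> Re z \<le> norm A"
    have "(Re z - norm A) * norm x \<le> norm (blinfun_apply A x - z *\<^sub>C x)" for x
    proof -
      have "norm (Re z *\<^sub>R x) \<le> norm (blinfun_apply A x - Re z *\<^sub>R x) + norm (blinfun_apply A x)"
        by (metis add.commute norm_minus_commute norm_triangle_sub)
      then have "Re z * norm x \<le> norm (blinfun_apply A x - Re z *\<^sub>R x) + norm (blinfun_apply A x)"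
        using \<open>Re z \<ge> 0\<close> by simp
      then show ?thesis using ge [of x] norm_blinfun [of A x] by (simp add: left_diff_distrib)
    qed
    with gt z show False unfolding bounded_below_at_def by (meson diff_gt_0_iff_gt not_le)
  qed
  ultimately show "z \<in> complex_of_real ` {0..norm A}"
    by (intro image_eqI [where x = "Re z"]) (auto simp: complex_eq_iff)
qed

lemma compact_spectrum_positive_operator:
  fixes A :: "'a::complex_hilbert_space \<Rightarrow>\<^sub>L 'a"
  assumes A: "positive_operator A"
  shows "compact (spectrum A)"
proof (rule compact_eq_bounded_closed [THEN iffD2, OF conjI])
  have "bounded (complex_of_real ` {0..norm A})"
    by (intro compact_imp_bounded compact_continuous_image continuous_intros) auto
  then show "bounded (spectrum A)"
    using spectrum_positive_operator_subset [OF A] by (rule bounded_subset)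
  have "open (- spectrum A)"
  proof (rule openI)
    fix z assume "z \<in> - spectrum A"
    then obtain c where c: "c > 0"
      and below: "\<And>x. c * norm x \<le> norm (blinfun_apply A x - z *\<^sub>C x)"
      by (auto simp: spectrum_positive_operator [OF A] bounded_below_at_def)
    have "w \<in> - spectrum A" if w: "w \<in> ball z (c / 2)" for w
    proof -
      have "c / 2 * norm x \<le> norm (blinfun_apply A x - w *\<^sub>C x)" for x
      proof -
        have "norm (blinfun_apply A x - z *\<^sub>C x)
            \<le> norm (blinfun_apply A x - w *\<^sub>C x) + norm ((w - z) *\<^sub>C x)"
          using norm_triangle_ineq [of "blinfun_apply A x - w *\<^sub>C x" "(w - z) *\<^sub>C x"]
          by (simp add: scaleC_diff_left)
        moreover have "norm ((w - z) *\<^sub>C x) \<le> c / 2 * norm x"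
          unfolding norm_scaleC using w
          by (intro mult_right_mono) (auto simp: dist_norm norm_minus_commute)
        ultimately show ?thesis using below [of x] by simp
      qed
      moreover have "c / 2 > 0" using c by simp
      ultimately show ?thesis
        unfolding spectrum_positive_operator [OF A] bounded_below_at_def by blast
    qed
    with c show "\<exists>e>0. ball z e \<subseteq> - spectrum A" by (meson half_gt_zero subsetI)
  qed
  then show "closed (spectrum A)" by (simp add: closed_def)
qed

section \<open>Polynomials in an operator\<close>

definition scaleC_blinfun :: "complex \<Rightarrow> ('a::complex_hilbert_space \<Rightarrow>\<^sub>L 'a)" where
  "scaleC_blinfun c = Blinfun (\<lambda>x. c *\<^sub>C x)"

lemma scaleC_blinfun_apply [simp]: "blinfun_apply (scaleC_blinfun c) x = c *\<^sub>C x"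
  by (simp add: scaleC_blinfun_def bounded_linear_Blinfun_apply bounded_linear_scaleC)

text \<open>This is Horner's scheme for \<open>p(A)\<close>.\<close>

definition poly_op ::
    "('a::complex_hilbert_space \<Rightarrow>\<^sub>L 'a) \<Rightarrow> complex poly \<Rightarrow> ('a \<Rightarrow>\<^sub>L 'a)" where
  "poly_op A p = fold_coeffs (\<lambda>c T. scaleC_blinfun c + (A o\<^sub>L T)) p 0"

lemma poly_op_0 [simp]: "poly_op A 0 = 0"
  by (simp add: poly_op_def)

lemma poly_op_pCons [simp]: "poly_op A (pCons a p) = scaleC_blinfun a + (A o\<^sub>L poly_op A p)"
  by (cases "p = 0 \<and> a = 0") (auto simp: poly_op_def intro!: blinfun_eqI)

lemma complex_operatorD: "complex_operator A \<Longrightarrow> blinfun_apply A (c *\<^sub>C x) = c *\<^sub>C blinfun_apply A x"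
  by (simp add: complex_operator_def)

lemma complex_operator_poly_op: "complex_operator A \<Longrightarrow> complex_operator (poly_op A p)"
  by (induction p)
    (simp_all add: complex_operator_def blinfun.add_left scaleC_add_right scaleC_scaleC mult.commute)

lemma poly_op_add: "poly_op A (p + q) = poly_op A p + poly_op A q"
proof (induction p q rule: poly_induct2)
  case (pCons a p b q)
  then show ?case
    by (auto intro!: blinfun_eqI
        simp: blinfun.add_left blinfun.add_right scaleC_add_left algebra_simps)
qed simp

lemma poly_op_diff: "poly_op A (p - q) = poly_op A p - poly_op A q"
  using poly_op_add [of A "p - q" q] by simp

lemma poly_op_smult:
  "complex_operator A \<Longrightarrow> blinfun_apply (poly_op A (smult c p)) x = c *\<^sub>C blinfun_apply (poly_op A p) x"
  by (induction p)
    (simp_all add: blinfun.add_left scaleC_add_right scaleC_scaleC complex_operatorD)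

lemma poly_op_mult:
  assumes "complex_operator A"
  shows "poly_op A (p * q) = poly_op A p o\<^sub>L poly_op A q"
proof (rule blinfun_eqI)
  fix x show "blinfun_apply (poly_op A (p * q)) x = blinfun_apply (poly_op A p o\<^sub>L poly_op A q) x"
    using assms by (induction p) (simp_all add: poly_op_add poly_op_smult blinfun.add_left)
qed

lemma poly_op_commute:
  assumes "complex_operator A"
  shows "blinfun_apply (poly_op A p) (blinfun_apply A x) = blinfun_apply A (blinfun_apply (poly_op A p) x)"
  using assms by (induction p) (simp_all add: blinfun.add_left blinfun.add_right complex_operatorD)

lemma poly_op_adjoint:
  assumes "positive_operator A"
  shows "cinner (blinfun_apply (poly_op A (map_poly cnj p)) x) y = cinner x (blinfun_apply (poly_op A p) y)"
proof -
  have A: "complex_operator A" using assms by (simp add: positive_operator_def)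
  show ?thesis
  proof (induction p arbitrary: x y)
    case (pCons a p)
    have "cinner (blinfun_apply A (blinfun_apply (poly_op A (map_poly cnj p)) x)) y
        = cinner x (blinfun_apply A (blinfun_apply (poly_op A p) y))"
      by (simp add: positive_operator_cinner_symmetric [OF assms] pCons.IH poly_op_commute [OF A])
    then show ?case by (simp add: map_poly_pCons blinfun.add_left cinner_simps)
  qed simp
qed

text \<open>Over the complex numbers \<open>p\<close> splits into linear factors, and a product of operators that are
  bounded below is bounded below.\<close>

lemma poly_op_bounded_below:
  assumes A: "complex_operator A" and "p \<noteq> 0"
    and "\<And>z. poly p z = 0 \<Longrightarrow> bounded_below_at A z"
  shows "\<exists>c>0. \<forall>x. c * norm x \<le> norm (blinfun_apply (poly_op A p) x)"
  using assms(2,3)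
proof (induction "degree p" arbitrary: p)
  case 0
  then obtain a where p: "p = [:a:]" by (metis degree_eq_zeroE)
  with 0 show ?case
    by (intro exI [where x = "cmod a"]) (simp add: norm_scaleC blinfun.add_left)
next
  case (Suc n)
  then obtain z where z: "poly p z = 0"
    using fundamental_theorem_of_algebra [of p] by (auto simp: constant_degree)
  then obtain q where p: "p = [:-z, 1:] * q" by (meson dvdE poly_eq_0_iff_dvd)
  with Suc.prems have "q \<noteq> 0" by auto
  then have "degree q = n" using Suc.hyps(2) unfolding p by (subst (asm) degree_mult_eq) auto
  moreover have "bounded_below_at A w" if "poly q w = 0" for w
    using Suc.prems(2) that by (simp add: p)
  ultimately obtain c where c: "c > 0"
    and q: "\<And>x. c * norm x \<le> norm (blinfun_apply (poly_op A q) x)"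
    using Suc.hyps(1) \<open>q \<noteq> 0\<close> by blast
  obtain d where d: "d > 0" and dz: "\<And>x. d * norm x \<le> norm (blinfun_apply A x - z *\<^sub>C x)"
    using Suc.prems(2) [OF z] by (auto simp: bounded_below_at_def)
  have "d * c * norm x \<le> norm (blinfun_apply (poly_op A p) x)" for x
  proof -
    have "d * c * norm x \<le> d * norm (blinfun_apply (poly_op A q) x)"
      using q d by (simp add: mult.assoc mult_left_mono)
    also have "\<dots> \<le> norm (blinfun_apply A (blinfun_apply (poly_op A q) x)
        - z *\<^sub>C blinfun_apply (poly_op A q) x)"
      by (rule dz)
    also have "blinfun_apply A (blinfun_apply (poly_op A q) x) - z *\<^sub>C blinfun_apply (poly_op A q) x
        = blinfun_apply (poly_op A p) x"
      unfolding p poly_op_mult [OF A]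
      by (simp add: blinfun.add_left scaleC_minus_left scaleC_one blinfun.diff_left
          complex_operatorD [OF A])
    finally show ?thesis .
  qed
  with c d show ?case by (intro exI [where x = "d * c"]) simp
qed

text \<open>Let \<open>T = p(A)\<close> with norm \<open>N\<close>.  Vectors that nearly attain the norm of \<open>T\<close> are approximate
  eigenvectors of \<open>T\<^sup>* T\<close> for \<open>N\<^sup>2\<close>, so the operator \<open>r(A) = T\<^sup>* T - N\<^sup>2\<close> is not bounded below.  Hence
  some root of \<open>r = p\<^sup>* p - N\<^sup>2\<close> lies in the spectrum, and at this real point \<open>\<bar>p\<bar> = N\<close>.  If
  \<open>r\<close> is the zero polynomial, its roots carry no information, which is why this case is excluded.\<close>

lemma norm_poly_op_attained:
  fixes A :: "'a::complex_hilbert_space \<Rightarrow>\<^sub>L 'a"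
  assumes A: "positive_operator A" and N: "norm (poly_op A p) = N" "N > 0"
    and q: "map_poly cnj p * p \<noteq> [:of_real (N\<^sup>2):]"
  shows "\<exists>z\<in>spectrum A. cmod (poly p z) = N"
proof (rule ccontr)
  assume none: "\<not> ?thesis"
  have cA: "complex_operator A" using A by (simp add: positive_operator_def)
  define T T' where "T = poly_op A p" and "T' = poly_op A (map_poly cnj p)"
  define r where "r = map_poly cnj p * p + [:- of_real (N\<^sup>2):]"
  have "r \<noteq> 0"
  proof
    assume "r = 0"
    then have "map_poly cnj p * p = - [:- of_real (N\<^sup>2):]"
      unfolding r_def by (metis eq_neg_iff_add_eq_0)
    with q show False by simp
  qed
  moreover have "bounded_below_at A z" if "poly r z = 0" for z
  proof (rule ccontr)
    assume "\<not> bounded_below_at A z"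
    then have z: "z \<in> spectrum A" using A by (simp add: spectrum_positive_operator)
    then have "cnj z = z"
      using spectrum_positive_operator_subset [OF A] by auto
    then have "poly (map_poly cnj p) z = cnj (poly p z)" using poly_cnj [of p z] by simp
    then have "poly p z * cnj (poly p z) = of_real (N\<^sup>2)"
      using that by (simp add: r_def mult.commute)
    then have "(cmod (poly p z))\<^sup>2 = N\<^sup>2"
      by (metis complex_norm_square of_real_eq_iff)
    with N have "cmod (poly p z) = N" by (simp add: power2_eq_iff_nonneg)
    with none z show False by blast
  qed
  ultimately obtain c where c: "c > 0"
    and below: "\<And>x. c * norm x \<le> norm (blinfun_apply (poly_op A r) x)"
    using poly_op_bounded_below [OF cA] by blast
  have r: "blinfun_apply (poly_op A r) x = blinfun_apply T' (blinfun_apply T x) - N\<^sup>2 *\<^sub>R x" for x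
    by (simp add: r_def poly_op_add poly_op_mult [OF cA] T_def T'_def blinfun.add_left
        scaleC_minus_left scaleR_scaleC)
  have adj: "inner (blinfun_apply T' x) y = inner x (blinfun_apply T y)" for x y
    by (simp add: T_def T'_def inner_eq_Re_cinner poly_op_adjoint [OF A])
  have T_le: "norm (blinfun_apply T x) \<le> N * norm x" for x
    using norm_blinfun [of T x] N by (simp add: T_def)
  have T'_le: "norm (blinfun_apply T' y) \<le> N * norm y" for y
  proof (cases "blinfun_apply T' y = 0")
    case False
    have "norm (blinfun_apply T' y) * norm (blinfun_apply T' y) = inner y (blinfun_apply T (blinfun_apply T' y))"
      by (metis adj power2_eq_square power2_norm_eq_inner)
    also have "\<dots> \<le> norm y * (N * norm (blinfun_apply T' y))"
      by (meson T_le mult_left_mono norm_cauchy_schwarz norm_ge_zero order_trans)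
    finally have "norm (blinfun_apply T' y) * norm (blinfun_apply T' y) \<le> N * norm y * norm (blinfun_apply T' y)"
      by (simp add: mult_ac)
    then show ?thesis by (rule mult_right_le_imp_le) (use False in simp)
  qed (use N in simp)
  have key: "N\<^sup>2 * (norm (blinfun_apply T x))\<^sup>2 \<le> (N^4 - c\<^sup>2) * (norm x)\<^sup>2" for x
  proof -
    have "(c * norm x)\<^sup>2 \<le> (norm (blinfun_apply T' (blinfun_apply T x) - N\<^sup>2 *\<^sub>R x))\<^sup>2"
      using below [of x] c unfolding r by (intro power_mono) auto
    also have "\<dots> = (norm (blinfun_apply T' (blinfun_apply T x)))\<^sup>2
        - 2 * N\<^sup>2 * (norm (blinfun_apply T x))\<^sup>2 + N^4 * (norm x)\<^sup>2"
    proof -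
      have "inner (blinfun_apply T' (blinfun_apply T x)) x = (norm (blinfun_apply T x))\<^sup>2"
        by (simp add: adj power2_norm_eq_inner)
      then show ?thesis
        unfolding dot_square_norm [symmetric]
        by (simp add: inner_diff_left inner_diff_right inner_commute [of x "blinfun_apply T' _"]
            power4_eq_xxxx power2_eq_square algebra_simps)
    qed
    also have "(norm (blinfun_apply T' (blinfun_apply T x)))\<^sup>2 \<le> N\<^sup>2 * (norm (blinfun_apply T x))\<^sup>2"
      by (metis T'_le norm_ge_zero power_mono power_mult_distrib)
    finally show ?thesis by (simp add: power_mult_distrib algebra_simps)
  qed
  define s where "s = sqrt (max 0 (N\<^sup>2 - c\<^sup>2 / N\<^sup>2))"
  have s: "s\<^sup>2 = max 0 (N\<^sup>2 - c\<^sup>2 / N\<^sup>2)" "s \<ge> 0" by (simp_all add: s_def)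
  have "norm T \<le> s"
  proof (rule norm_blinfun_bound [OF s(2)], rule power2_le_imp_le)
    fix x
    have "(norm (blinfun_apply T x))\<^sup>2 \<le> (N\<^sup>2 - c\<^sup>2 / N\<^sup>2) * (norm x)\<^sup>2"
      using key [of x] N by (simp add: field_simps power4_eq_xxxx power2_eq_square)
    also have "\<dots> \<le> s\<^sup>2 * (norm x)\<^sup>2" unfolding s by (intro mult_right_mono) auto
    finally show "(norm (blinfun_apply T x))\<^sup>2 \<le> (s * norm x)\<^sup>2" by (simp add: power_mult_distrib)
  qed (use s in simp)
  then have "N\<^sup>2 \<le> s\<^sup>2" using N s by (intro power_mono) (auto simp: T_def)
  moreover have "c\<^sup>2 / N\<^sup>2 > 0" using c N by simp
  moreover have "N\<^sup>2 > 0" using N by simp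
  ultimately show False unfolding s by linarith
qed

lemma spectrum_nonempty:
  fixes A :: "'a::complex_hilbert_space \<Rightarrow>\<^sub>L 'a"
  assumes A: "positive_operator A" and x: "(x::'a) \<noteq> 0"
  shows "spectrum A \<noteq> {}"
proof (cases "A = 0")
  case True
  then have "\<not> bounded_below_at A 0"
    unfolding bounded_below_at_def using x
    by (auto simp: mult_le_0_iff not_le intro!: exI [where x = x])
  then show ?thesis using A by (auto simp: spectrum_positive_operator)
next
  case False
  have "poly_op A [:0, 1:] = A"
    by (rule blinfun_eqI) (simp add: blinfun.add_left scaleC_one)
  then show ?thesis
    using norm_poly_op_attained [OF A, of "[:0, 1:]" "norm A"] False
    by (auto simp: map_poly_pCons)
qed

text \<open>By \<open>norm_poly_op_attained\<close> the norm of \<open>p(A)\<close> is a value of \<open>\<bar>p\<bar>\<close> on the spectrum, so that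
  \<open>p \<mapsto> p(A)\<close> is contractive for the supremum norm there.  When \<open>p\<^sup>* p\<close> is constant, any point of the spectrum shows the bound, and there
  is one as soon as the space is nontrivial.\<close>

lemma norm_poly_op_le:
  fixes A :: "'a::complex_hilbert_space \<Rightarrow>\<^sub>L 'a"
  assumes A: "positive_operator A" and "M \<ge> 0" and M: "\<And>z. z \<in> spectrum A \<Longrightarrow> cmod (poly p z) \<le> M"
  shows "norm (poly_op A p) \<le> M"
proof (rule ccontr)
  assume gt: "\<not> ?thesis"
  define N where "N = norm (poly_op A p)"
  have N: "N > M" "N > 0" using gt \<open>M \<ge> 0\<close> by (auto simp: N_def)
  show False
  proof (cases "map_poly cnj p * p = [:of_real (N\<^sup>2):]")
    case True
    have "poly_op A p \<noteq> 0" using N by (auto simp: N_def)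
    then obtain x where "blinfun_apply (poly_op A p) x \<noteq> 0"
      by (metis blinfun_eqI blinfun.zero_left)
    then have "x \<noteq> 0" by (metis blinfun.zero_right)
    then obtain z where z: "z \<in> spectrum A" using spectrum_nonempty [OF A] by blast
    then have "cnj z = z"
      using spectrum_positive_operator_subset [OF A] by auto
    then have "poly (map_poly cnj p) z = cnj (poly p z)" using poly_cnj [of p z] by simp
    then have "poly p z * cnj (poly p z) = of_real (N\<^sup>2)"
      using arg_cong [OF True, of "\<lambda>q. poly q z"] by (simp add: mult.commute)
    then have "(cmod (poly p z))\<^sup>2 = N\<^sup>2"
      by (metis complex_norm_square of_real_eq_iff)
    with N have "cmod (poly p z) = N" by (simp add: power2_eq_iff_nonneg)
    then show False using M [OF z] N by simp
  next
    case False
    then show False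
      using norm_poly_op_attained [OF A N_def [symmetric] N(2)] M N by force
  qed
qed

section \<open>The continuous functional calculus\<close>

text \<open>The closure of the graph of \<open>p \<mapsto> p(A)\<close> for uniform convergence on the spectrum.  A relation is
  used because the algebraic laws pass to the limit before existence and uniqueness are known.\<close>

definition poly_limit ::
    "('a::complex_hilbert_space \<Rightarrow>\<^sub>L 'a) \<Rightarrow> (complex \<Rightarrow> complex) \<Rightarrow> ('a \<Rightarrow>\<^sub>L 'a) \<Rightarrow> bool" where
  "poly_limit A h T \<longleftrightarrow> (\<exists>p. uniform_limit (spectrum A) (\<lambda>n. poly (p n)) h sequentially \<and>
     (\<lambda>n. poly_op A (p n)) \<longlonglongrightarrow> T)"

lemma poly_limit_poly: "poly_limit A (poly p) (poly_op A p)"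
  unfolding poly_limit_def by (rule exI [where x = "\<lambda>_. p"]) (simp add: uniform_limit_const)

lemma poly_limit_add:
  "poly_limit A h T \<Longrightarrow> poly_limit A k S \<Longrightarrow> poly_limit A (\<lambda>z. h z + k z) (T + S)"
  unfolding poly_limit_def
proof (elim exE conjE)
  fix p q
  assume "uniform_limit (spectrum A) (\<lambda>n. poly (p n)) h sequentially"
    "uniform_limit (spectrum A) (\<lambda>n. poly (q n)) k sequentially"
    "(\<lambda>n. poly_op A (p n)) \<longlonglongrightarrow> T" "(\<lambda>n. poly_op A (q n)) \<longlonglongrightarrow> S"
  then show "\<exists>p. uniform_limit (spectrum A) (\<lambda>n. poly (p n)) (\<lambda>z. h z + k z) sequentially \<and>
     (\<lambda>n. poly_op A (p n)) \<longlonglongrightarrow> T + S"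
    by (intro exI [where x = "\<lambda>n. p n + q n"])
      (simp add: poly_op_add tendsto_add uniform_limit_add poly_add [abs_def])
qed

lemma poly_limit_diff:
  "poly_limit A h T \<Longrightarrow> poly_limit A k S \<Longrightarrow> poly_limit A (\<lambda>z. h z - k z) (T - S)"
  unfolding poly_limit_def
proof (elim exE conjE)
  fix p q
  assume "uniform_limit (spectrum A) (\<lambda>n. poly (p n)) h sequentially"
    "uniform_limit (spectrum A) (\<lambda>n. poly (q n)) k sequentially"
    "(\<lambda>n. poly_op A (p n)) \<longlonglongrightarrow> T" "(\<lambda>n. poly_op A (q n)) \<longlonglongrightarrow> S"
  then show "\<exists>p. uniform_limit (spectrum A) (\<lambda>n. poly (p n)) (\<lambda>z. h z - k z) sequentially \<and>
     (\<lambda>n. poly_op A (p n)) \<longlonglongrightarrow> T - S"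
    by (intro exI [where x = "\<lambda>n. p n - q n"])
      (simp add: poly_op_diff tendsto_diff uniform_limit_minus poly_diff [abs_def])
qed

lemma poly_limit_mult:
  assumes A: "positive_operator A"
    and h: "continuous_on (spectrum A) h" "poly_limit A h T"
    and k: "continuous_on (spectrum A) k" "poly_limit A k S"
  shows "poly_limit A (\<lambda>z. h z * k z) (T o\<^sub>L S)"
proof -
  have cA: "complex_operator A" using A by (simp add: positive_operator_def)
  have bdd: "bounded (h ` spectrum A)" "bounded (k ` spectrum A)"
    using h k compact_spectrum_positive_operator [OF A]
    by (auto intro: compact_imp_bounded compact_continuous_image)
  obtain p q where
    "uniform_limit (spectrum A) (\<lambda>n. poly (p n)) h sequentially"
    "uniform_limit (spectrum A) (\<lambda>n. poly (q n)) k sequentially"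
    "(\<lambda>n. poly_op A (p n)) \<longlonglongrightarrow> T" "(\<lambda>n. poly_op A (q n)) \<longlonglongrightarrow> S"
    using h k unfolding poly_limit_def by blast
  then show ?thesis
    unfolding poly_limit_def
    by (intro exI [where x = "\<lambda>n. p n * q n"])
      (simp add: poly_op_mult [OF cA] uniform_lim_mult bdd poly_mult [abs_def]
        bounded_bilinear.tendsto [OF bounded_bilinear_blinfun_compose])
qed

lemma poly_limit_norm_le:
  assumes A: "positive_operator A" and h: "poly_limit A h T"
    and "M \<ge> 0" and M: "\<And>z. z \<in> spectrum A \<Longrightarrow> cmod (h z) \<le> M"
  shows "norm T \<le> M"
proof (rule field_le_epsilon)
  fix e :: real assume e: "e > 0"
  obtain p where p: "uniform_limit (spectrum A) (\<lambda>n. poly (p n)) h sequentially"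
    and T: "(\<lambda>n. poly_op A (p n)) \<longlonglongrightarrow> T"
    using h unfolding poly_limit_def by blast
  have "\<forall>\<^sub>F n in sequentially. norm (poly_op A (p n)) \<le> M + e"
    using uniform_limitD [OF p e]
  proof eventually_elim
    case (elim n)
    show ?case
    proof (rule norm_poly_op_le [OF A])
      fix z assume z: "z \<in> spectrum A"
      have "cmod (poly (p n) z) \<le> cmod (h z) + dist (poly (p n) z) (h z)"
        by (simp add: dist_norm norm_triangle_sub)
      then show "cmod (poly (p n) z) \<le> M + e"
        using elim [rule_format, OF z] M [OF z] by linarith
    qed (use \<open>M \<ge> 0\<close> e in simp)
  qed
  then show "norm T \<le> M + e"
    using tendsto_norm [OF T] by (metis tendsto_upperbound sequentially_bot)
qed

lemma poly_limit_complex_operator: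
  assumes A: "complex_operator A" and h: "poly_limit A h T"
  shows "complex_operator T"
  unfolding complex_operator_def
proof (intro allI)
  fix c x
  obtain p where T: "(\<lambda>n. poly_op A (p n)) \<longlonglongrightarrow> T"
    using h unfolding poly_limit_def by blast
  have lim: "(\<lambda>n. blinfun_apply (poly_op A (p n)) x) \<longlonglongrightarrow> blinfun_apply T x" for x
    using T by (intro tendsto_intros)
  have "(\<lambda>n. c *\<^sub>C blinfun_apply (poly_op A (p n)) x) \<longlonglongrightarrow> c *\<^sub>C blinfun_apply T x"
    by (rule bounded_linear.tendsto [OF bounded_linear_scaleC lim])
  moreover have "(\<lambda>n. c *\<^sub>C blinfun_apply (poly_op A (p n)) x) \<longlonglongrightarrow> blinfun_apply T (c *\<^sub>C x)"
    using lim [of "c *\<^sub>C x"] by (simp add: complex_operatorD [OF complex_operator_poly_op [OF A]])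
  ultimately show "blinfun_apply T (c *\<^sub>C x) = c *\<^sub>C blinfun_apply T x"
    using LIMSEQ_unique by blast
qed

lemma poly_limit_scaleC_blinfun: "poly_limit A (\<lambda>_. c) (scaleC_blinfun c)"
  using poly_limit_poly [of A "[:c:]"] by (simp add: poly_pCons [abs_def])

lemma tendsto_cinner_left:
  fixes y :: "'a::complex_inner"
  assumes "(f \<longlongrightarrow> l) F"
  shows "((\<lambda>n. cinner (f n) y) \<longlongrightarrow> cinner l y) F"
proof -
  have "cinner x y = Complex (inner x y) (inner x (\<i> *\<^sub>C y))" for x
    by (simp add: inner_eq_Re_cinner cinner_simps complex_eq_iff)
  then show ?thesis using assms by (auto intro!: tendsto_intros)
qed

lemma poly_limit_unique:
  assumes "positive_operator A" and "poly_limit A h T" "poly_limit A h S"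
  shows "T = S"
  using poly_limit_norm_le [OF assms(1) poly_limit_diff [OF assms(2,3)], of 0] by simp

lemma poly_limit_tendsto:
  assumes A: "positive_operator A" and h: "poly_limit A h T"
    and q: "uniform_limit (spectrum A) (\<lambda>n. poly (q n)) h sequentially"
  shows "(\<lambda>n. poly_op A (q n)) \<longlonglongrightarrow> T"
proof (rule tendstoI)
  fix e :: real assume "e > 0"
  then have e: "e / 2 > 0" by simp
  show "\<forall>\<^sub>F n in sequentially. dist (poly_op A (q n)) T < e"
    using uniform_limitD [OF q e]
  proof eventually_elim
    case (elim n)
    have "norm (poly_op A (q n) - T) \<le> e / 2"
      using elim e
      by (intro poly_limit_norm_le [OF A poly_limit_diff [OF poly_limit_poly h]])
        (auto simp: dist_norm less_imp_le)
    with e show ?case by (simp add: dist_norm)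
  qed
qed

text \<open>The spectrum is real, so conjugating the coefficients of approximating polynomials of \<open>h\<close> yields
  approximating polynomials of the conjugate of \<open>h\<close>, and for polynomials the identity is
  \<open>poly_op_adjoint\<close>.\<close>

lemma poly_limit_adjoint:
  assumes A: "positive_operator A" and h: "poly_limit A h T" and h': "poly_limit A (\<lambda>z. cnj (h z)) S"
  shows "cinner (blinfun_apply S x) y = cinner x (blinfun_apply T y)"
proof -
  obtain p where p: "uniform_limit (spectrum A) (\<lambda>n. poly (p n)) h sequentially"
    and T: "(\<lambda>n. poly_op A (p n)) \<longlonglongrightarrow> T"
    using h unfolding poly_limit_def by blast
  have fixed: "cnj z = z" if "z \<in> spectrum A" for z
    using that spectrum_positive_operator_subset [OF A] by auto
  let ?p' = "\<lambda>n. map_poly cnj (p n)"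
  have poly': "poly (?p' n) z = cnj (poly (p n) z)" if "z \<in> spectrum A" for n z
    using poly_cnj [of "p n" z] fixed [OF that] by simp
  have "uniform_limit (spectrum A) (\<lambda>n. poly (?p' n)) (\<lambda>z. cnj (h z)) sequentially"
  proof (rule uniform_limitI)
    fix e :: real assume "e > 0"
    have "dist (poly (?p' n) z) (cnj (h z)) = dist (poly (p n) z) (h z)"
      if "z \<in> spectrum A" for n z
      by (metis poly' [OF that] complex_cnj_diff complex_mod_cnj dist_norm)
    with uniform_limitD [OF p \<open>e > 0\<close>]
    show "\<forall>\<^sub>F n in sequentially. \<forall>z\<in>spectrum A. dist (poly (?p' n) z) (cnj (h z)) < e"
      by (simp cong: ball_cong)
  qed
  then have S: "(\<lambda>n. poly_op A (?p' n)) \<longlonglongrightarrow> S"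
    by (rule poly_limit_tendsto [OF A h'])
  have "(\<lambda>n. cinner (blinfun_apply (poly_op A (?p' n)) x) y) \<longlonglongrightarrow> cinner (blinfun_apply S x) y"
    using S by (intro tendsto_cinner_left tendsto_intros)
  moreover have "(\<lambda>n. cnj (cinner (blinfun_apply (poly_op A (p n)) y) x))
      \<longlonglongrightarrow> cnj (cinner (blinfun_apply T y) x)"
    using T by (intro tendsto_cinner_left tendsto_intros)
  moreover have "cnj (cinner (blinfun_apply (poly_op A (p n)) y) x)
      = cinner (blinfun_apply (poly_op A (?p' n)) x) y" for n
    by (simp add: poly_op_adjoint [OF A] flip: cinner_commute)
  ultimately show ?thesis
    by (simp add: LIMSEQ_unique flip: cinner_commute)
qed

lemma exists_complex_poly_near_on_reals:
  fixes h :: "complex \<Rightarrow> complex"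
  assumes K: "compact K" "K \<subseteq> \<real>" and h: "continuous_on K h" and e: "e > 0"
  shows "\<exists>p. \<forall>z\<in>K. cmod (poly p z - h z) < e"
proof -
  have real: "of_real (Re z) = z" if "z \<in> K" for z using K that by (auto simp: Reals_def)
  have "compact (Re ` K)" using K by (intro compact_continuous_image continuous_intros)
  have weierstrass: "\<exists>p. \<forall>t\<in>Re ` K. \<bar>poly p t - u t\<bar> < e / 2"
    if u: "continuous_on (Re ` K) u" for u :: "real \<Rightarrow> real"
  proof -
    have "\<exists>g. (\<exists>p. g = poly p) \<and> (\<forall>t\<in>Re ` K. \<bar>u t - g t\<bar> < e / 2)"
    proof (rule Stone_Weierstrass_HOL [OF \<open>compact (Re ` K)\<close> _ _ _ _ _ u])
      show "\<exists>p. (\<lambda>x. c) = poly p" for c :: real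
        by (rule exI [where x = "[:c:]"]) auto
      show "\<exists>r. (\<lambda>x. f x + g x) = poly r" "\<exists>r. (\<lambda>x. f x * g x) = poly r"
        if "(\<exists>p. f = poly p) \<and> (\<exists>p. g = poly p)" for f g :: "real \<Rightarrow> real"
      proof -
        from that obtain p q where "f = poly p" "g = poly q" by blast
        then have "(\<lambda>x. f x + g x) = poly (p + q)" "(\<lambda>x. f x * g x) = poly (p * q)"
          by auto
        then show "\<exists>r. (\<lambda>x. f x + g x) = poly r" "\<exists>r. (\<lambda>x. f x * g x) = poly r"
          by blast+
      qed
      show "\<exists>f. (\<exists>p. f = poly p) \<and> f x \<noteq> f y" if "x \<in> Re ` K \<and> y \<in> Re ` K \<and> x \<noteq> y" for x y
        using that by (intro exI [where x = "poly [:0, 1:]"]) auto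
    qed (use e in \<open>auto intro: continuous_intros\<close>)
    then show ?thesis by (metis abs_minus_commute)
  qed
  have of_real_Re: "complex_of_real ` Re ` K = K"
    using real by (force simp: image_image)
  have "continuous_on (Re ` K) (\<lambda>t. h (of_real t))"
    using h by (intro continuous_on_compose2 [OF h] continuous_intros) (auto simp: real)
  then have "continuous_on (Re ` K) (\<lambda>t. Re (h (of_real t)))" "continuous_on (Re ` K) (\<lambda>t. Im (h (of_real t)))"
    by (auto intro: continuous_intros)
  then obtain p q where p: "\<And>z. z \<in> K \<Longrightarrow> \<bar>poly p (Re z) - Re (h (of_real (Re z)))\<bar> < e / 2"
    and q: "\<And>z. z \<in> K \<Longrightarrow> \<bar>poly q (Re z) - Im (h (of_real (Re z)))\<bar> < e / 2"
    using weierstrass by (metis imageI)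
  have of_real_poly: "poly (map_poly complex_of_real r) (of_real t) = of_real (poly r t)" for r t
    by (induction r) (auto simp: map_poly_pCons)
  define r where "r = map_poly of_real p + smult \<i> (map_poly of_real q)"
  have "cmod (poly r z - h z) < e" if z: "z \<in> K" for z
  proof -
    have "poly r z = Complex (poly p (Re z)) (poly q (Re z))"
      using of_real_poly [of _ "Re z"] real [OF z] by (simp add: r_def complex_eq_iff)
    then have "cmod (poly r z - h z) \<le> \<bar>poly p (Re z) - Re (h z)\<bar> + \<bar>poly q (Re z) - Im (h z)\<bar>"
      using cmod_le [of "poly r z - h z"] by simp
    then show ?thesis using p [OF z] q [OF z] real [OF z] by simp
  qed
  then show ?thesis by blast
qed

text \<open>By the Weierstrass theorem polynomials \<open>p\<^sub>n\<close> converge to \<open>h\<close> uniformly on the spectrum, and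
  contractivity turns this into a Cauchy sequence \<open>p\<^sub>n(A)\<close>.\<close>

lemma poly_limit_exists:
  assumes A: "positive_operator A" and h: "continuous_on (spectrum A) h"
  shows "\<exists>T. poly_limit A h T"
proof -
  have "\<exists>p. \<forall>z\<in>spectrum A. cmod (poly p z - h z) < inverse (real (Suc n))" for n
    using spectrum_positive_operator_subset [OF A]
    by (intro exists_complex_poly_near_on_reals [OF compact_spectrum_positive_operator [OF A] _ h]) auto
  then obtain p where p: "\<And>n z. z \<in> spectrum A \<Longrightarrow> cmod (poly (p n) z - h z) < inverse (real (Suc n))"
    by metis
  have lim: "uniform_limit (spectrum A) (\<lambda>n. poly (p n)) h sequentially"
  proof (rule uniform_limitI)
    fix e :: real assume "e > 0"
    with LIMSEQ_inverse_real_of_nat have "\<forall>\<^sub>F n in sequentially. inverse (real (Suc n)) < e"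
      by (rule order_tendstoD)
    then show "\<forall>\<^sub>F n in sequentially. \<forall>z\<in>spectrum A. dist (poly (p n) z) (h z) < e"
      by eventually_elim (use p in \<open>auto simp: dist_norm intro: less_trans\<close>)
  qed
  have "Cauchy (\<lambda>n. poly_op A (p n))"
  proof (rule metric_CauchyI)
    fix e :: real assume "e > 0"
    then have e: "e / 4 > 0" by simp
    obtain N where N: "\<And>n z. n \<ge> N \<Longrightarrow> z \<in> spectrum A \<Longrightarrow> dist (poly (p n) z) (h z) < e / 4"
      using uniform_limitD [OF lim e] unfolding eventually_sequentially by blast
    have "dist (poly_op A (p m)) (poly_op A (p n)) < e" if "m \<ge> N" "n \<ge> N" for m n
    proof -
      have "norm (poly_op A (p m - p n)) \<le> e / 2"
      proof (rule norm_poly_op_le [OF A])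
        fix z assume z: "z \<in> spectrum A"
        show "cmod (poly (p m - p n) z) \<le> e / 2"
          using dist_triangle_half_r [of "h z" "poly (p m) z" "e / 2" "poly (p n) z"]
            N [OF that(1) z] N [OF that(2) z]
          by (simp add: dist_commute dist_norm)
      qed (use e in simp)
      then show ?thesis using e by (simp add: dist_norm poly_op_diff)
    qed
    then show "\<exists>M. \<forall>m\<ge>M. \<forall>n\<ge>M. dist (poly_op A (p m)) (poly_op A (p n)) < e" by blast
  qed
  then obtain T where "(\<lambda>n. poly_op A (p n)) \<longlonglongrightarrow> T"
    using Cauchy_convergent convergent_def by blast
  with lim show ?thesis unfolding poly_limit_def by blast
qed

text \<open>A functional calculus is an algebra homomorphism that sends the identity function to \<open>A\<close>, so it
  is determined on polynomials, and by contractivity on their uniform limits.  This is the uniqueness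
  behind \<open>op_fun\<close>.\<close>

lemma functional_calculus_poly_limit:
  assumes A: "positive_operator A" and \<Phi>: "functional_calculus A \<Phi>" and h: "continuous_on (spectrum A) h"
  shows "poly_limit A h (\<Phi> h)"
proof -
  note F = \<Phi> [unfolded functional_calculus_def]
  have one: "\<Phi> (\<lambda>z. 1) = id_blinfun" and ident: "\<Phi> (\<lambda>z. z) = A"
    using F by blast+
  have scale: "blinfun_apply (\<Phi> (\<lambda>z. c * k z)) x = c *\<^sub>C blinfun_apply (\<Phi> k) x"
    and bound: "M \<ge> 0 \<Longrightarrow> (\<And>z. z \<in> spectrum A \<Longrightarrow> cmod (k z) \<le> M) \<Longrightarrow> norm (\<Phi> k) \<le> M"
    if "continuous_on (spectrum A) k" for c k x M
    using F that by blast+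
  have add: "\<Phi> (\<lambda>z. k z + l z) = \<Phi> k + \<Phi> l" and mult: "\<Phi> (\<lambda>z. k z * l z) = \<Phi> k o\<^sub>L \<Phi> l"
    if "continuous_on (spectrum A) k" "continuous_on (spectrum A) l" for k l
    using F that by blast+
  have const: "\<Phi> (\<lambda>z. c) = scaleC_blinfun c" for c
    using scale [of "\<lambda>z. 1" c] by (intro blinfun_eqI) (simp add: one)
  have cont: "continuous_on (spectrum A) (poly q)" for q :: "complex poly"
    by (intro continuous_intros)
  have poly: "\<Phi> (poly q) = poly_op A q" for q
  proof (induction q)
    case 0
    then show ?case using const [of 0] by (auto intro!: blinfun_eqI simp: fun_eq_iff poly_0 [abs_def])
  next
    case (pCons a q)
    have "\<Phi> (\<lambda>z. a + z * poly q z) = scaleC_blinfun a + (A o\<^sub>L \<Phi> (poly q))"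
      by (subst add) (auto simp: const mult ident cont intro!: continuous_intros)
    then show ?case by (simp add: pCons.IH poly_pCons [abs_def])
  qed
  obtain p where p: "uniform_limit (spectrum A) (\<lambda>n. poly (p n)) h sequentially"
    using poly_limit_exists [OF A h] unfolding poly_limit_def by blast
  have "(\<lambda>n. poly_op A (p n)) \<longlonglongrightarrow> \<Phi> h"
  proof (rule tendstoI)
    fix e :: real assume "e > 0"
    then have e: "e / 2 > 0" by simp
    show "\<forall>\<^sub>F n in sequentially. dist (poly_op A (p n)) (\<Phi> h) < e"
      using uniform_limitD [OF p e]
    proof eventually_elim
      case (elim n)
      have "\<Phi> (\<lambda>z. poly (p n) z + (- 1) * h z) = poly_op A (p n) + \<Phi> (\<lambda>z. (- 1) * h z)"
        using h by (subst add) (auto simp: cont poly intro!: continuous_intros)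
      moreover have "\<Phi> (\<lambda>z. (- 1) * h z) = - \<Phi> h"
        using scale [OF h, of "-1"]
        by (intro blinfun_eqI) (simp add: scaleC_minus_left scaleC_one blinfun.minus_left)
      moreover have "norm (\<Phi> (\<lambda>z. poly (p n) z + (- 1) * h z)) \<le> e / 2"
        using elim e h
        by (intro bound) (auto simp: dist_norm less_imp_le cont intro!: continuous_intros)
      ultimately show ?case using e by (simp add: dist_norm)
    qed
  qed
  with p show ?thesis unfolding poly_limit_def by blast
qed

lemma functional_calculus_exists:
  assumes A: "positive_operator A"
  shows "\<exists>\<Phi>. functional_calculus A \<Phi>"
proof
  define \<Phi> where "\<Phi> h = (THE T. poly_limit A h T)" for h
  have cA: "complex_operator A" using A by (simp add: positive_operator_def)
  have eq: "\<Phi> h = T" if "poly_limit A h T" for h T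
    unfolding \<Phi>_def using that by (rule the_equality) (rule poly_limit_unique [OF A _ that])
  have lim: "poly_limit A h (\<Phi> h)" if "continuous_on (spectrum A) h" for h
    using poly_limit_exists [OF A that] eq by metis
  show "functional_calculus A \<Phi>"
    unfolding functional_calculus_def
  proof (intro conjI allI impI)
    show "\<Phi> (\<lambda>z. 1) = id_blinfun"
      using eq [OF poly_limit_scaleC_blinfun [of A 1]]
      by (auto intro!: blinfun_eqI simp: scaleC_one)
    have "poly_op A [:0, 1:] = A" by (rule blinfun_eqI) (simp add: blinfun.add_left scaleC_one)
    then show "\<Phi> (\<lambda>z. z) = A"
      using eq [OF poly_limit_poly [of A "[:0, 1:]"]] by (simp add: poly_pCons [abs_def])
  next
    fix h :: "complex \<Rightarrow> complex" assume h: "continuous_on (spectrum A) h"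
    show "complex_operator (\<Phi> h)" using lim [OF h] by (rule poly_limit_complex_operator [OF cA])
    show "blinfun_apply (\<Phi> (\<lambda>z. c * h z)) x = c *\<^sub>C blinfun_apply (\<Phi> h) x" for c x
      using eq [OF poly_limit_mult [OF A _ poly_limit_scaleC_blinfun h lim [OF h]]] by simp
    show "cinner (blinfun_apply (\<Phi> (\<lambda>z. cnj (h z))) x) y = cinner x (blinfun_apply (\<Phi> h) y)" for x y
      using h by (intro poly_limit_adjoint [OF A lim lim]) (auto intro: continuous_intros)
    show "norm (\<Phi> h) \<le> M" if "M \<ge> 0" "\<forall>z\<in>spectrum A. cmod (h z) \<le> M" for M
      using poly_limit_norm_le [OF A lim [OF h]] that by blast
  next
    fix h k :: "complex \<Rightarrow> complex" assume "continuous_on (spectrum A) h \<and> continuous_on (spectrum A) k"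
    then have hk: "continuous_on (spectrum A) h" "continuous_on (spectrum A) k" by auto
    show "\<Phi> (\<lambda>z. h z + k z) = \<Phi> h + \<Phi> k"
      using hk by (intro eq poly_limit_add lim)
    show "\<Phi> (\<lambda>z. h z * k z) = \<Phi> h o\<^sub>L \<Phi> k"
      using hk by (intro eq poly_limit_mult [OF A] lim)
  qed
qed

section \<open>Real functions of a positive operator\<close>

lemma op_fun_poly_limit:
  assumes A: "positive_operator A" and u: "continuous_on {0..norm A} u"
  shows "poly_limit A (\<lambda>z. complex_of_real (u (Re z))) (op_fun u A)"
proof -
  let ?u = "\<lambda>z. complex_of_real (u (Re z))"
  have "continuous_on (spectrum A) (\<lambda>z. u (Re z))"
    using spectrum_positive_operator_subset [OF A]
    by (intro continuous_on_compose2 [OF u] continuous_intros) auto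
  then have cont: "continuous_on (spectrum A) ?u" by (intro continuous_intros)
  obtain \<Phi> where \<Phi>: "functional_calculus A \<Phi>" using functional_calculus_exists [OF A] by blast
  have "op_fun u A = \<Phi> ?u"
    unfolding op_fun_def
  proof (rule the_equality)
    fix T assume "\<exists>\<Phi>. functional_calculus A \<Phi> \<and> T = \<Phi> ?u"
    then show "T = \<Phi> ?u"
      using functional_calculus_poly_limit [OF A _ cont] poly_limit_unique [OF A] \<Phi> by blast
  qed (use \<Phi> in blast)
  then show ?thesis using functional_calculus_poly_limit [OF A \<Phi> cont] by simp
qed

lemma poly_limit_cong:
  assumes "\<And>z. z \<in> spectrum A \<Longrightarrow> h z = k z"
  shows "poly_limit A h T \<longleftrightarrow> poly_limit A k T"
proof -
  have "uniform_limit (spectrum A) f h sequentially \<longleftrightarrow> uniform_limit (spectrum A) f k sequentially" for f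
    using assms by (intro uniform_limit_cong') auto
  then show ?thesis by (simp add: poly_limit_def)
qed

lemma op_fun_eqI:
  assumes A: "positive_operator A" and u: "continuous_on {0..norm A} u"
    and T: "poly_limit A (\<lambda>z. complex_of_real (u (Re z))) T"
  shows "op_fun u A = T"
  using poly_limit_unique [OF A op_fun_poly_limit [OF A u] T] .

lemma continuous_on_spectrum:
  assumes A: "positive_operator A" and u: "continuous_on {0..norm A} u"
  shows "continuous_on (spectrum A) (\<lambda>z. complex_of_real (u (Re z)))"
  using spectrum_positive_operator_subset [OF A]
  by (intro continuous_on_of_real continuous_on_compose2 [OF u] continuous_intros) auto

lemma op_fun_cong:
  assumes A: "positive_operator A" and u: "continuous_on {0..norm A} u"
    and eq: "\<And>t. t \<in> {0..norm A} \<Longrightarrow> u t = v t"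
  shows "op_fun u A = op_fun v A"
proof -
  have v: "continuous_on {0..norm A} v"
    using u eq by (simp only: continuous_on_cong [OF refl eq])
  have "complex_of_real (u (Re z)) = complex_of_real (v (Re z))" if "z \<in> spectrum A" for z
    using spectrum_positive_operator_subset [OF A] that eq by auto
  then have "poly_limit A (\<lambda>z. complex_of_real (u (Re z))) (op_fun v A)"
    using op_fun_poly_limit [OF A v] by (subst poly_limit_cong) auto
  then show ?thesis by (rule op_fun_eqI [OF A u])
qed

lemma op_fun_const:
  assumes "positive_operator A"
  shows "op_fun (\<lambda>t. c) A = c *\<^sub>R id_blinfun"
proof -
  have "op_fun (\<lambda>t. c) A = scaleC_blinfun (complex_of_real c)"
    by (rule op_fun_eqI [OF assms continuous_on_const poly_limit_scaleC_blinfun])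
  also have "\<dots> = c *\<^sub>R id_blinfun"
    by (rule blinfun_eqI) (simp add: scaleR_scaleC blinfun.scaleR_left)
  finally show ?thesis .
qed

lemma op_fun_ident:
  assumes A: "positive_operator A"
  shows "op_fun (\<lambda>t. t) A = A"
proof (rule op_fun_eqI [OF A])
  have "poly_op A [:0, 1:] = A" by (rule blinfun_eqI) (simp add: blinfun.add_left scaleC_one)
  then have "poly_limit A (\<lambda>z. z) A"
    using poly_limit_poly [of A "[:0, 1:]"] by (simp add: poly_pCons [abs_def])
  moreover have "complex_of_real (Re z) = z" if "z \<in> spectrum A" for z
    using spectrum_positive_operator_subset [OF A] that by auto
  ultimately show "poly_limit A (\<lambda>z. complex_of_real (Re z)) A"
    by (subst poly_limit_cong [where k = "\<lambda>z. z"]) auto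
qed (rule continuous_on_id)

lemma op_fun_add:
  assumes A: "positive_operator A" and "continuous_on {0..norm A} u" "continuous_on {0..norm A} v"
  shows "op_fun (\<lambda>t. u t + v t) A = op_fun u A + op_fun v A"
  using poly_limit_add [OF op_fun_poly_limit op_fun_poly_limit, of A u v] assms
  by (intro op_fun_eqI) (auto intro: continuous_intros)

lemma op_fun_mult:
  assumes A: "positive_operator A" and "continuous_on {0..norm A} u" "continuous_on {0..norm A} v"
  shows "op_fun (\<lambda>t. u t * v t) A = op_fun u A o\<^sub>L op_fun v A"
proof (rule op_fun_eqI [OF A])
  show "poly_limit A (\<lambda>z. complex_of_real (u (Re z) * v (Re z))) (op_fun u A o\<^sub>L op_fun v A)"
    unfolding of_real_mult
    using assms by (intro poly_limit_mult continuous_on_spectrum op_fun_poly_limit)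
qed (use assms in \<open>intro continuous_intros\<close>)

lemma op_fun_cmult:
  assumes "positive_operator A" and "continuous_on {0..norm A} u"
  shows "op_fun (\<lambda>t. c * u t) A = c *\<^sub>R op_fun u A"
  using op_fun_mult [OF assms(1) continuous_on_const assms(2), of c] assms
  by (auto intro!: blinfun_eqI simp: op_fun_const blinfun.scaleR_left)

lemma op_fun_diff:
  assumes A: "positive_operator A" and "continuous_on {0..norm A} u" "continuous_on {0..norm A} v"
  shows "op_fun (\<lambda>t. u t - v t) A = op_fun u A - op_fun v A"
  using op_fun_add [OF A assms(2), of "\<lambda>t. (-1) * v t"] op_fun_cmult [OF A assms(3), of "-1"] assms
  by (simp add: continuous_on_minus)

lemma op_fun_sum:
  assumes A: "positive_operator A" and "\<And>i. i \<in> I \<Longrightarrow> continuous_on {0..norm A} (u i)"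
  shows "op_fun (\<lambda>t. \<Sum>i\<in>I. u i t) A = (\<Sum>i\<in>I. op_fun (u i) A)"
  using assms(2)
proof (induction I rule: infinite_finite_induct)
  case (insert i I)
  then show ?case by (simp add: op_fun_add [OF A] continuous_on_sum)
qed (simp_all add: op_fun_const [OF A])

lemma op_fun_symmetric:
  assumes A: "positive_operator A" and u: "continuous_on {0..norm A} u"
  shows "inner (op_fun u A x) y = inner x (op_fun u A y)"
  unfolding inner_eq_Re_cinner
  using poly_limit_adjoint [OF A op_fun_poly_limit [OF A u], of "op_fun u A" x y] op_fun_poly_limit [OF A u]
  by simp

lemma norm_op_fun_diff_le:
  assumes A: "positive_operator A" and u: "continuous_on {0..norm A} u" "continuous_on {0..norm A} v"
    and "M \<ge> 0" and M: "\<And>t. t \<in> {0..norm A} \<Longrightarrow> \<bar>u t - v t\<bar> \<le> M"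
  shows "norm (op_fun u A - op_fun v A) \<le> M"
proof (rule poly_limit_norm_le [OF A poly_limit_diff \<open>M \<ge> 0\<close>])
  fix z assume "z \<in> spectrum A"
  then show "cmod (complex_of_real (u (Re z)) - complex_of_real (v (Re z))) \<le> M"
    using spectrum_positive_operator_subset [OF A] M by (auto simp flip: of_real_diff)
qed (use op_fun_poly_limit [OF A] u in auto)

text \<open>\<open>u(A)\<close> is the square of the symmetric operator \<open>(sqrt u)(A)\<close>.\<close>

lemma op_fun_nonneg:
  assumes A: "positive_operator A" and u: "continuous_on {0..norm A} u"
    and nonneg: "\<And>t. t \<in> {0..norm A} \<Longrightarrow> 0 \<le> u t"
  shows "0 \<le> inner (op_fun u A x) x"
proof -
  have s: "continuous_on {0..norm A} (\<lambda>t. sqrt (u t))" using u by (intro continuous_intros)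
  have "op_fun u A = op_fun (\<lambda>t. sqrt (u t) * sqrt (u t)) A"
    using nonneg by (intro op_fun_cong [OF A u]) simp
  then have "inner (op_fun u A x) x = inner (op_fun (\<lambda>t. sqrt (u t)) A x) (op_fun (\<lambda>t. sqrt (u t)) A x)"
    by (simp only: op_fun_mult [OF A s s] blinfun_apply_blinfun_compose op_fun_symmetric [OF A s])
  then show ?thesis by simp
qed

lemma op_fun_mono:
  assumes A: "positive_operator A" and u: "continuous_on {0..norm A} u" "continuous_on {0..norm A} v"
    and le: "\<And>t. t \<in> {0..norm A} \<Longrightarrow> u t \<le> v t"
  shows "inner (op_fun u A x) x \<le> inner (op_fun v A x) x"
  using op_fun_nonneg [OF A, of "\<lambda>t. v t - u t" x] u le
  by (simp add: op_fun_diff [OF A] continuous_on_diff blinfun.diff_left inner_diff_left)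

lemma norm_op_fun_power2:
  assumes A: "positive_operator A" and u: "continuous_on {0..norm A} u"
  shows "(norm (op_fun u A x))\<^sup>2 = inner (op_fun (\<lambda>t. u t * u t) A x) x"
  by (simp add: power2_norm_eq_inner op_fun_mult [OF A u u] op_fun_symmetric [OF A u])

lemma norm_op_fun_mono:
  assumes A: "positive_operator A" and u: "continuous_on {0..norm A} u" "continuous_on {0..norm A} v"
    and le: "\<And>t. t \<in> {0..norm A} \<Longrightarrow> \<bar>u t\<bar> \<le> \<bar>v t\<bar>"
  shows "norm (op_fun u A x) \<le> norm (op_fun v A x)"
proof (rule power2_le_imp_le)
  have "u t * u t \<le> v t * v t" if "t \<in> {0..norm A}" for t
    using le [OF that] by (simp add: abs_le_square_iff flip: power2_eq_square)
  then show "(norm (op_fun u A x))\<^sup>2 \<le> (norm (op_fun v A x))\<^sup>2"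
    unfolding norm_op_fun_power2 [OF A u(1)] norm_op_fun_power2 [OF A u(2)]
    using u by (intro op_fun_mono [OF A] continuous_intros)
qed simp

text \<open>This is the nonnegativity of the form of \<open>P\<close> at \<open>x - P x / N\<close>.  A vector that nearly annihilates
  the form of a positive operator is therefore nearly annihilated by the operator.\<close>

lemma positive_form_Cauchy_Schwarz:
  fixes P :: "'a::real_inner \<Rightarrow>\<^sub>L 'a"
  assumes sym: "\<And>x y. inner (P x) y = inner x (P y)" and pos: "\<And>x. 0 \<le> inner (P x) x"
    and N: "norm P \<le> N"
  shows "(norm (P x))\<^sup>2 \<le> N * inner (P x) x"
proof (cases "N > 0")
  case True
  have "inner (P (P x)) (P x) \<le> norm (P (P x)) * norm (P x)" by (rule norm_cauchy_schwarz)
  also have "\<dots> \<le> (N * norm (P x)) * norm (P x)"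
    by (intro mult_right_mono order_trans [OF norm_blinfun] N) auto
  finally have PP: "inner (P (P x)) (P x) \<le> N * (norm (P x))\<^sup>2" by (simp add: power2_eq_square)
  define s where "s = 1 / N"
  have "0 \<le> inner (P (x - s *\<^sub>R P x)) (x - s *\<^sub>R P x)" by (rule pos)
  also have "\<dots> = inner (P x) x - 2 * s * (norm (P x))\<^sup>2 + s\<^sup>2 * inner (P (P x)) (P x)"
    by (simp add: blinfun.diff_right blinfun.scaleR_right inner_diff_left inner_diff_right
        sym [of "P x" x] power2_eq_square algebra_simps flip: power2_norm_eq_inner)
  also have "\<dots> \<le> inner (P x) x - 2 * s * (norm (P x))\<^sup>2 + s\<^sup>2 * (N * (norm (P x))\<^sup>2)"
    using PP by (simp add: mult_left_mono)
  also have "\<dots> = inner (P x) x - (norm (P x))\<^sup>2 / N"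
    using True by (simp add: s_def field_simps power2_eq_square)
  finally show ?thesis using True by (simp add: field_simps)
next
  case False
  with N have "P = 0" by (metis norm_le_zero_iff order_trans not_less)
  then show ?thesis by simp
qed

section \<open>Concave functions\<close>

lemma concave_on_below_tangent:
  assumes f: "concave_on {0..} f" and D: "(f has_real_derivative D) (at x)" and x: "0 < x" and s: "0 \<le> s"
  shows "f s \<le> f x + D * (s - x)"
proof -
  have "((\<lambda>x. - f x) has_real_derivative - D) (at x within {0..})"
    using D by (intro DERIV_minus) (rule has_field_derivative_at_within)
  then have "- f s - - f x \<ge> (- D) * (s - x)"
    using f x s by (intro convex_on_imp_above_tangent [of "{0..}"])
      (auto simp: concave_on_def)
  then show ?thesis by (simp add: algebra_simps)
qed

text \<open>Bounds that are uniform in \<open>x \<in> [\<delta>, R]\<close>, although the derivative of \<open>f\<close> may blow up at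
  \<open>0\<close> and tend to \<open>0\<close> at infinity.  They come from the chords over \<open>[0, x]\<close> and
  \<open>[x, R + 1]\<close>.\<close>

lemma concave_slope_bounds:
  assumes f: "concave_on {0..} f" and D: "(f has_real_derivative D) (at x)"
    and mono: "strict_mono_on {0..} f" and \<delta>: "0 < \<delta>" "\<delta> \<le> x" "x \<le> R"
  shows "0 < D" "D \<le> (f R - f 0) / \<delta>" and "(f (R + 1) - f R) / (R + 1) \<le> D"
    and "0 \<le> t \<Longrightarrow> \<bar>f t - f x\<bar> \<le> (f R - f 0) / \<delta> * \<bar>t - x\<bar>"
proof -
  have x: "x > 0" using \<delta> by simp
  note tangent = concave_on_below_tangent [OF f D x]
  have less: "f s < f t" if "0 \<le> s" "s < t" for s t
    using mono that by (auto simp: strict_mono_on_def)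
  have le: "f s \<le> f t" if "0 \<le> s" "s \<le> t" for s t
    using less [of s t] that by (cases "s = t") auto
  show D_pos: "0 < D" using tangent [of "x + 1"] less [of x "x + 1"] x by simp
  have quot: "(f x - f 0) / x \<le> (f R - f 0) / \<delta>"
    using \<delta> le [of x R] le [of 0 x] by (intro frac_le) auto
  have "D \<le> (f x - f 0) / x" using tangent [of 0] x by (simp add: field_simps)
  with quot show D_le: "D \<le> (f R - f 0) / \<delta>" by linarith
  have "f (R + 1) - f R \<le> D * (R + 1 - x)"
    using tangent [of "R + 1"] \<delta> le [of x R] by simp
  also have "\<dots> \<le> D * (R + 1)" using D_pos x by (intro mult_left_mono) auto
  finally show "(f (R + 1) - f R) / (R + 1) \<le> D" using \<delta> by (simp add: field_simps)
  show "\<bar>f t - f x\<bar> \<le> (f R - f 0) / \<delta> * \<bar>t - x\<bar>" if t: "0 \<le> t"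
  proof (cases "t \<ge> x")
    case True
    have "f t - f x \<le> D * (t - x)" using tangent [OF t] by simp
    also have "\<dots> \<le> (f R - f 0) / \<delta> * (t - x)" using D_le True by (intro mult_right_mono) auto
    finally show ?thesis using True le [of x t] x by simp
  next
    case False
    have "f ((1 - t / x) *\<^sub>R 0 + (t / x) *\<^sub>R x) \<ge> (1 - t / x) * f 0 + t / x * f x"
      using f x False t by (intro concave_onD) auto
    then have "f t \<ge> f 0 + t / x * (f x - f 0)" using x by (simp add: algebra_simps)
    moreover have "(f x - f 0) / x * (x - t) = f x - (f 0 + t / x * (f x - f 0))"
      using x by (simp add: field_simps)
    ultimately have "f x - f t \<le> (f x - f 0) / x * (x - t)" by linarith
    also have "\<dots> \<le> (f R - f 0) / \<delta> * (x - t)" using quot False by (intro mult_right_mono) auto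
    finally show ?thesis using False le [of t x] t by simp
  qed
qed

text \<open>Taylor's formula gives this for \<open>t \<ge> \<delta>/2\<close>, where the second derivative is bounded.  For
  smaller \<open>t\<close> the distance \<open>x - t\<close> is at least \<open>\<delta>/2\<close>, so a large enough quadratic term outweighs
  the oscillation of \<open>f\<close>.\<close>

lemma quadratic_minorant:
  fixes f :: "real \<Rightarrow> real"
  assumes f: "concave_on {0..} f" and mono: "strict_mono_on {0..} f"
    and f': "\<And>t. t > 0 \<Longrightarrow> (f has_real_derivative f' t) (at t)"
    and f'': "\<And>t. t > 0 \<Longrightarrow> (f' has_real_derivative f'' t) (at t)"
    and cont: "continuous_on {0<..} f''" and \<delta>: "0 < \<delta>" "\<delta> \<le> R"
  shows "\<exists>K\<ge>0. \<forall>x\<in>{\<delta>..R}. \<forall>t\<in>{0..R}. f x + f' x * (t - x) - K * (t - x)\<^sup>2 \<le> f t"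
proof -
  have le: "f s \<le> f t" if "0 \<le> s" "s \<le> t" for s t
    using mono that by (cases "s = t") (auto simp: strict_mono_on_def less_imp_le)
  have "continuous_on {\<delta>/2..R} f''"
    using cont by (rule continuous_on_subset) (use \<delta> in auto)
  then have "bounded (f'' ` {\<delta>/2..R})"
    by (intro compact_imp_bounded compact_continuous_image) auto
  then obtain M where M: "\<And>t. t \<in> {\<delta>/2..R} \<Longrightarrow> \<bar>f'' t\<bar> \<le> M"
    unfolding bounded_iff by (metis imageI real_norm_def)
  have "M \<ge> 0" using M [of R] \<delta> by auto
  define N where "N = (f R - f 0) * (4 / \<delta>\<^sup>2)"
  have "N \<ge> 0" using le [of 0 R] \<delta> by (simp add: N_def)
  have "f x + f' x * (t - x) - (M + N) * (t - x)\<^sup>2 \<le> f t" if x: "x \<in> {\<delta>..R}" and t: "t \<in> {0..R}" for x t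
  proof (cases "t \<ge> \<delta> / 2")
    case True
    have "f x + f' x * (t - x) - M * (t - x)\<^sup>2 \<le> f t"
    proof (cases "t = x")
      case False
      define diff where "diff m = (if m = 0 then f else if m = 1 then f' else f'')" for m :: nat
      have "\<exists>c. (if t < x then t < c \<and> c < x else x < c \<and> c < t) \<and>
          f t = (\<Sum>m<2. (diff m x / fact m) * (t - x)^m) + (diff 2 c / fact 2) * (t - x)^2"
      proof (rule Taylor [where a = "\<delta>/2" and b = R])
        show "\<forall>m t. m < 2 \<and> \<delta> / 2 \<le> t \<and> t \<le> R \<longrightarrow> (diff m has_real_derivative diff (Suc m) t) (at t)"
          using f' f'' \<delta> by (auto simp: diff_def less_2_cases_iff)
      qed (use x t True False \<delta> in \<open>auto simp: diff_def\<close>)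
      then obtain c where c: "if t < x then t < c \<and> c < x else x < c \<and> c < t"
        and eq: "f t = f x + f' x * (t - x) + f'' c / 2 * (t - x)\<^sup>2"
        by (auto simp: diff_def numeral_2_eq_2)
      have "\<bar>f'' c\<bar> \<le> M" using c x t True \<delta> by (intro M) (auto split: if_splits)
      then have "- M * (t - x)\<^sup>2 \<le> f'' c / 2 * (t - x)\<^sup>2"
        using \<open>M \<ge> 0\<close> by (intro mult_right_mono) auto
      with eq show ?thesis by simp
    qed simp
    moreover have "N * (t - x)\<^sup>2 \<ge> 0" using \<open>N \<ge> 0\<close> by simp
    ultimately show ?thesis by (simp add: distrib_right)
  next
    case False
    have "f' x > 0" using concave_slope_bounds(1) [OF f f' mono \<delta>(1)] x \<delta> by auto
    then have "f' x * (t - x) \<le> 0" using False x \<delta> by (intro mult_nonneg_nonpos) auto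
    have "(\<delta> / 2)\<^sup>2 \<le> (x - t)\<^sup>2" using False x \<delta> by (intro power_mono) auto
    then have "1 \<le> 4 / \<delta>\<^sup>2 * (t - x)\<^sup>2"
      using \<delta> by (simp add: field_simps power2_commute [of t x])
    then have "(f R - f 0) * 1 \<le> (f R - f 0) * (4 / \<delta>\<^sup>2 * (t - x)\<^sup>2)"
      using le [of 0 R] \<delta> by (intro mult_left_mono) auto
    then have "f R - f 0 \<le> N * (t - x)\<^sup>2" by (simp only: N_def mult.assoc mult_1_right)
    moreover have "f x \<le> f R" "f 0 \<le> f t" using le x t \<delta> by auto
    moreover have "M * (t - x)\<^sup>2 \<ge> 0" using \<open>M \<ge> 0\<close> by simp
    ultimately show ?thesis using \<open>f' x * (t - x) \<le> 0\<close> by (simp add: distrib_right)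
  qed
  with \<open>M \<ge> 0\<close> \<open>N \<ge> 0\<close> show ?thesis by (intro exI [where x = "M + N"]) auto
qed

section \<open>Operators squeezed by the inequalities\<close>

text \<open>At the mean \<open>x = \<langle>X \<zeta>, \<zeta>\<rangle>\<close> the linear term drops out and the quadratic term is the variance of
  \<open>X\<close> in the state \<open>\<zeta>\<close>.\<close>

lemma op_fun_quadratic:
  assumes X: "positive_operator X" and "norm \<zeta> = 1" and x: "inner (X \<zeta>) \<zeta> = x"
  shows "inner (op_fun (\<lambda>t. a + b * (t - x) - c * (t - x)\<^sup>2) X \<zeta>) \<zeta> = a - c * (norm (X \<zeta> - x *\<^sub>R \<zeta>))\<^sup>2"
proof -
  have cont: "continuous_on {0..norm X} (\<lambda>t. t - x)" by (intro continuous_intros)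
  have shift: "op_fun (\<lambda>t. t - x) X = X - x *\<^sub>R id_blinfun"
    by (simp add: op_fun_diff [OF X] op_fun_ident [OF X] op_fun_const [OF X] continuous_on_id)
  have "op_fun (\<lambda>t. a + b * (t - x) - c * (t - x)\<^sup>2) X
      = a *\<^sub>R id_blinfun + b *\<^sub>R op_fun (\<lambda>t. t - x) X - c *\<^sub>R op_fun (\<lambda>t. (t - x) * (t - x)) X"
    using cont by (simp add: op_fun_diff [OF X] op_fun_add [OF X] op_fun_cmult [OF X] op_fun_const [OF X]
        continuous_intros power2_eq_square)
  moreover have "inner (op_fun (\<lambda>t. (t - x) * (t - x)) X \<zeta>) \<zeta> = (norm (X \<zeta> - x *\<^sub>R \<zeta>))\<^sup>2"
    using norm_op_fun_power2 [OF X cont, of \<zeta>]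
    by (simp add: shift blinfun.diff_left blinfun.scaleR_left)
  moreover have "inner \<zeta> \<zeta> = 1" using assms(2) by (simp add: dot_square_norm)
  ultimately show ?thesis
    by (simp add: shift blinfun.diff_left blinfun.add_left blinfun.scaleR_left inner_diff_left
        inner_add_left x)
qed

text \<open>\<open>Z\<close> and \<open>f(X)\<close> differ on \<open>\<zeta>\<close> at most by a multiple of the deviation of \<open>\<zeta>\<close> from being an eigenvector
  of \<open>X\<close>.  For a unit vector \<open>\<zeta>\<close> with mean \<open>x\<close> and variance \<open>v\<^sup>2\<close>, the quadratic minorant of \<open>g \<circ> f\<close>
  at \<open>x\<close> turns the lower inequality into \<open>f x - \<langle>Z \<zeta>, \<zeta>\<rangle> \<le> K v\<^sup>2 / m\<close>.  The upper inequality and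
  concavity make \<open>P = f x + f' x (X - x) - Z\<close> a positive operator, and \<open>\<langle>P \<zeta>, \<zeta>\<rangle>\<close> is exactly that gap.
  By Cauchy-Schwarz \<open>P \<zeta>\<close> has norm of order \<open>v\<close>, and so has \<open>Z \<zeta> - f(X) \<zeta>\<close>.  The mean is kept
  above \<open>\<delta>\<close> since the constants depend on the second derivatives, which may blow up at \<open>0\<close>.\<close>

lemma deviation_bound:
  fixes X Z :: "'a::complex_hilbert_space \<Rightarrow>\<^sub>L 'a" and f g :: "real \<Rightarrow> real"
  assumes f_pos: "\<And>t. t > 0 \<Longrightarrow> 0 < f t" and f0: "0 \<le> f 0"
    and f: "strict_mono_on {0..} f" "concave_on {0..} f" "C2_on {0<..} f" "continuous_on {0..} f"
    and g: "strict_mono_on {0..} g" "concave_on {0..} g" "C2_on {0<..} g" "continuous_on {0..} g"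
    and X: "positive_operator X"
    and sym: "\<And>x y. inner (Z x) y = inner x (Z y)" and Z_pos: "\<And>x. 0 \<le> inner (Z x) x"
    and lower: "\<And>\<xi>. norm \<xi> = 1 \<Longrightarrow> inner (op_fun (g \<circ> f) X \<xi>) \<xi> \<le> g (inner (Z \<xi>) \<xi>)"
    and upper: "\<And>\<xi>. norm \<xi> = 1 \<Longrightarrow> inner (Z \<xi>) \<xi> \<le> f (inner (X \<xi>) \<xi>)"
    and \<delta>: "\<delta> > 0"
  shows "\<exists>C\<ge>0. \<forall>\<zeta> l. \<delta> * (norm \<zeta>)\<^sup>2 \<le> inner (X \<zeta>) \<zeta> \<longrightarrow>
    norm (Z \<zeta> - op_fun f X \<zeta>) \<le> C * norm (X \<zeta> - l *\<^sub>R \<zeta>)"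
proof -
  obtain f' f'' where f': "\<And>t. t > 0 \<Longrightarrow> (f has_real_derivative f' t) (at t)"
    and f'': "\<And>t. t > 0 \<Longrightarrow> (f' has_real_derivative f'' t) (at t)" and f''_cont: "continuous_on {0<..} f''"
    using f(3) unfolding C2_on_def by (auto simp: at_within_open [OF _ open_greaterThan])
  obtain g' g'' where g': "\<And>t. t > 0 \<Longrightarrow> (g has_real_derivative g' t) (at t)"
    and g'': "\<And>t. t > 0 \<Longrightarrow> (g' has_real_derivative g'' t) (at t)" and g''_cont: "continuous_on {0<..} g''"
    using g(3) unfolding C2_on_def by (auto simp: at_within_open [OF _ open_greaterThan])
  define R where "R = norm X + \<delta>"
  have R: "\<delta> \<le> R" "norm X \<le> R" using \<delta> by (auto simp: R_def)
  define \<sigma> S where "\<sigma> = f \<delta>" and "S = f R"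
  have f_le: "f s \<le> f t" if "0 \<le> s" "s \<le> t" for s t
    using strict_mono_on_leD [OF f(1)] that by auto
  have f_nonneg: "0 \<le> f t" if "0 \<le> t" for t using f_le [of 0 t] f0 that by simp
  have g_less: "g s < g t" if "0 \<le> s" "s < t" for s t
    using g(1) that by (auto simp: strict_mono_on_def)
  have \<sigma>: "0 < \<sigma>" "\<sigma> \<le> S" using f_pos \<delta> R f_le by (auto simp: \<sigma>_def S_def)
  \<comment> \<open>\<open>L\<close> and \<open>G\<close> bound the slopes of \<open>f\<close> and
    \<open>g\<close> from above on the relevant intervals, \<open>m\<close> bounds the slopes of
    \<open>g\<close> from below.\<close>
  define L where "L = (f R - f 0) / \<delta>"
  have L: "L \<ge> 0" using f_le [of 0 R] R \<delta> by (simp add: L_def)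
  define G where "G = (g S - g 0) / \<sigma>"
  have G: "G \<ge> 0" using g_less [of 0 S] \<sigma> by (simp add: G_def)
  define m where "m = (g (S + 1) - g S) / (S + 1)"
  have m: "m > 0" using g_less [of S "S + 1"] \<sigma> by (simp add: m_def)
  obtain K1 where K1: "K1 \<ge> 0"
    and f_quad: "\<And>x t. x \<in> {\<delta>..R} \<Longrightarrow> t \<in> {0..R} \<Longrightarrow> f x + f' x * (t - x) - K1 * (t - x)\<^sup>2 \<le> f t"
    using quadratic_minorant [OF f(2,1) f' f'' f''_cont \<delta> R(1)] by blast
  obtain K2 where K2: "K2 \<ge> 0"
    and g_quad: "\<And>x t. x \<in> {\<sigma>..S} \<Longrightarrow> t \<in> {0..S} \<Longrightarrow> g x + g' x * (t - x) - K2 * (t - x)\<^sup>2 \<le> g t"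
    using quadratic_minorant [OF g(2,1) g' g'' g''_cont \<sigma>] by blast
  define K where "K = G * K1 + K2 * L\<^sup>2"
  have K: "K \<ge> 0" using G K1 K2 by (simp add: K_def)
  \<comment> \<open>\<open>Q\<close> bounds the norm of the operator \<open>P\<close> uniformly in
    the mean \<open>x\<close>.\<close>
  define Q where "Q = S + 2 * (L * R) + norm Z"
  have Q: "Q \<ge> 0" using L R \<delta> \<sigma> by (simp add: Q_def)
  define C where "C = 2 * L + sqrt (Q * (K / m))"
  have C: "C \<ge> 0" using L Q K m by (simp add: C_def)
  have contf: "continuous_on {0..norm X} f" using f(4) by (rule continuous_on_subset) auto
  have contgf: "continuous_on {0..norm X} (g \<circ> f)"
    unfolding comp_def
    by (rule continuous_on_compose2 [OF g(4) contf]) (auto intro: f_nonneg)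
  have unit: "norm (Z \<zeta> - op_fun f X \<zeta>) \<le> C * norm (X \<zeta> - inner (X \<zeta>) \<zeta> *\<^sub>R \<zeta>)"
    if \<zeta>: "norm \<zeta> = 1" and ge: "\<delta> \<le> inner (X \<zeta>) \<zeta>" for \<zeta>
  proof -
    define x where "x = inner (X \<zeta>) \<zeta>"
    define v where "v = norm (X \<zeta> - x *\<^sub>R \<zeta>)"
    define a where "a = f' x"
    define b where "b = g' (f x)"
    define z where "z = inner (Z \<zeta>) \<zeta>"
    have "x \<le> norm X"
      using norm_cauchy_schwarz [of "X \<zeta>" \<zeta>] norm_blinfun [of X \<zeta>] \<zeta> by (simp add: x_def)
    then have x: "\<delta> \<le> x" "x \<le> R" "0 < x" using ge R \<delta> by (auto simp: x_def)
    have fx: "\<sigma> \<le> f x" "f x \<le> S" "0 < f x" using f_le x \<delta> \<sigma> f_pos by (auto simp: \<sigma>_def S_def)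
    note fb = concave_slope_bounds [OF f(2) f' [OF x(3)] f(1) \<delta> x(1,2), folded a_def L_def]
    note gb = concave_slope_bounds [OF g(2) g' [OF fx(3)] g(1) \<sigma>(1) fx(1,2), folded b_def G_def m_def]
    \<comment> \<open>The quadratic minorants of \<open>g\<close> at \<open>f x\<close> and of
      \<open>f\<close> at \<open>x\<close> compose to one of \<open>g \<circ> f\<close>.\<close>
    have h: "g (f x) + b * a * (t - x) - K * (t - x)\<^sup>2 \<le> g (f t)" if t: "t \<in> {0..norm X}" for t
    proof -
      have t': "t \<in> {0..R}" "0 \<le> t" using t R by auto
      have "0 \<le> f t" "f t \<le> S" using f_nonneg [of t] f_le [of t R] t' by (auto simp: S_def)
      then have "g (f x) + b * (f t - f x) - K2 * (f t - f x)\<^sup>2 \<le> g (f t)"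
        using g_quad [of "f x" "f t"] fx by (simp add: b_def)
      moreover have "b * (a * (t - x) - K1 * (t - x)\<^sup>2) \<le> b * (f t - f x)"
        using f_quad [OF _ t'(1), of x] x gb(1) by (intro mult_left_mono) (auto simp: a_def)
      moreover have "(f t - f x)\<^sup>2 \<le> (L * \<bar>t - x\<bar>)\<^sup>2"
        using fb(4) [OF t'(2)] L by (intro abs_le_square_iff [THEN iffD1]) (simp add: abs_mult)
      then have "K2 * (f t - f x)\<^sup>2 \<le> K2 * (L\<^sup>2 * (t - x)\<^sup>2)"
        using K2 by (intro mult_left_mono) (auto simp: power_mult_distrib)
      moreover have "b * (K1 * (t - x)\<^sup>2) \<le> G * (K1 * (t - x)\<^sup>2)"
        using gb(2) K1 by (intro mult_right_mono) auto
      ultimately show ?thesis by (simp add: K_def algebra_simps)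
    qed
    have "g (f x) - K * v\<^sup>2
        = inner (op_fun (\<lambda>t. g (f x) + b * a * (t - x) - K * (t - x)\<^sup>2) X \<zeta>) \<zeta>"
      using op_fun_quadratic [OF X \<zeta> x_def [symmetric]] by (simp add: v_def)
    also have "\<dots> \<le> inner (op_fun (g \<circ> f) X \<zeta>) \<zeta>"
      using h by (intro op_fun_mono [OF X _ contgf] continuous_intros) auto
    also have "\<dots> \<le> g z" using lower [OF \<zeta>] by (simp add: z_def)
    finally have gap_g: "g (f x) - K * v\<^sup>2 \<le> g z" .
    have z: "0 \<le> z" "z \<le> f x" using Z_pos upper [OF \<zeta>] by (auto simp: z_def x_def)
    have "g z \<le> g (f x) + b * (z - f x)"
      using concave_on_below_tangent [OF g(2) g' [OF fx(3)] fx(3) z(1)] by (simp add: b_def)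
    moreover have "b * (z - f x) \<le> m * (z - f x)"
      using gb(3) z by (intro mult_right_mono_neg) auto
    ultimately have "m * (f x - z) \<le> K * v\<^sup>2" using gap_g by (simp add: algebra_simps)
    then have gap: "f x - z \<le> K / m * v\<^sup>2" using m by (simp add: field_simps)
    define P where "P = (f x - a * x) *\<^sub>R id_blinfun + a *\<^sub>R X - Z"
    have P: "P \<omega> = (f x - a * x) *\<^sub>R \<omega> + a *\<^sub>R X \<omega> - Z \<omega>" for \<omega>
      by (simp add: P_def blinfun.diff_left blinfun.add_left blinfun.scaleR_left)
    have P_sym: "inner (P \<omega>) \<eta> = inner \<omega> (P \<eta>)" for \<omega> \<eta>
      by (simp add: P inner_diff_left inner_diff_right inner_add_left inner_add_right sym
          positive_operator_symmetric [OF X])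
    have P_unit: "0 \<le> inner (P \<omega>) \<omega>" if \<omega>: "norm \<omega> = 1" for \<omega>
    proof -
      have "inner (Z \<omega>) \<omega> \<le> f (inner (X \<omega>) \<omega>)" by (rule upper [OF \<omega>])
      also have "\<dots> \<le> f x + a * (inner (X \<omega>) \<omega> - x)"
        unfolding a_def
        by (rule concave_on_below_tangent [OF f(2) f' x(3) positive_operator_inner_nonneg [OF X]]) (rule x(3))
      finally show ?thesis
        using \<omega> by (simp add: P inner_diff_left inner_add_left dot_square_norm algebra_simps)
    qed
    have P_pos: "0 \<le> inner (P \<omega>) \<omega>" for \<omega>
    proof (cases "\<omega> = 0")
      case False
      have "inner (P \<omega>) \<omega> = (norm \<omega>)\<^sup>2 * inner (P (\<omega> /\<^sub>R norm \<omega>)) (\<omega> /\<^sub>R norm \<omega>)"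
        using False by (simp add: blinfun.scaleR_right power2_eq_square field_simps)
      then show ?thesis using P_unit [of "\<omega> /\<^sub>R norm \<omega>"] False by simp
    qed simp
    have "norm P \<le> Q"
    proof -
      have "norm P \<le> norm ((f x - a * x) *\<^sub>R id_blinfun :: 'a \<Rightarrow>\<^sub>L 'a) + norm (a *\<^sub>R X) + norm Z"
        unfolding P_def by (meson add_mono norm_triangle_ineq norm_triangle_ineq4 order_refl order_trans)
      moreover have "norm ((f x - a * x) *\<^sub>R id_blinfun :: 'a \<Rightarrow>\<^sub>L 'a) \<le> \<bar>f x - a * x\<bar>"
        by (simp add: mult_left_le norm_blinfun_id_le)
      moreover have "a * x \<le> L * R" "a * norm X \<le> L * R"
        using fb(1,2) x R L by (auto intro!: mult_mono)
      moreover have "a * x \<ge> 0" using fb(1) x by simp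
      ultimately show ?thesis using fx fb(1) by (simp add: Q_def)
    qed
    then have "(norm (P \<zeta>))\<^sup>2 \<le> Q * inner (P \<zeta>) \<zeta>"
      by (rule positive_form_Cauchy_Schwarz [OF P_sym P_pos])
    also have "inner (P \<zeta>) \<zeta> = f x - z"
      using \<zeta> by (simp add: P inner_diff_left inner_add_left dot_square_norm x_def z_def algebra_simps)
    also have "Q * (f x - z) \<le> Q * (K / m * v\<^sup>2)" using gap Q by (intro mult_left_mono) auto
    also have "\<dots> = (sqrt (Q * (K / m)) * v)\<^sup>2" using Q K m by (simp add: power_mult_distrib)
    finally have P_le: "norm (P \<zeta>) \<le> sqrt (Q * (K / m)) * v"
      by (rule power2_le_imp_le) (use Q K m in \<open>simp add: v_def\<close>)
    have f_le_v: "norm (op_fun f X \<zeta> - f x *\<^sub>R \<zeta>) \<le> L * v"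
    proof -
      have "norm (op_fun (\<lambda>t. f t - f x) X \<zeta>) \<le> norm (op_fun (\<lambda>t. L * (t - x)) X \<zeta>)"
        using fb(4) L by (intro norm_op_fun_mono [OF X] continuous_intros contf) (auto simp: abs_mult)
      moreover have "op_fun (\<lambda>t. f t - f x) X \<zeta> = op_fun f X \<zeta> - f x *\<^sub>R \<zeta>"
        by (simp add: op_fun_diff [OF X contf] op_fun_const [OF X] continuous_on_const
            blinfun.diff_left blinfun.scaleR_left)
      moreover have "op_fun (\<lambda>t. L * (t - x)) X \<zeta> = L *\<^sub>R (X \<zeta> - x *\<^sub>R \<zeta>)"
        by (simp add: op_fun_cmult [OF X] op_fun_diff [OF X] op_fun_ident [OF X] op_fun_const [OF X]
            continuous_intros blinfun.diff_left blinfun.scaleR_left)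
      ultimately show ?thesis using L by (simp add: v_def)
    qed
    have "Z \<zeta> - op_fun f X \<zeta> = a *\<^sub>R (X \<zeta> - x *\<^sub>R \<zeta>) - P \<zeta> - (op_fun f X \<zeta> - f x *\<^sub>R \<zeta>)"
      by (simp add: P algebra_simps)
    then have "norm (Z \<zeta> - op_fun f X \<zeta>)
        \<le> norm (a *\<^sub>R (X \<zeta> - x *\<^sub>R \<zeta>)) + norm (P \<zeta>) + norm (op_fun f X \<zeta> - f x *\<^sub>R \<zeta>)"
      by (metis (no_types, lifting) add_right_mono norm_triangle_ineq4 order_trans)
    moreover have "norm (a *\<^sub>R (X \<zeta> - x *\<^sub>R \<zeta>)) \<le> L * v"
      using fb(1,2) by (simp add: v_def mult_right_mono)
    ultimately have "norm (Z \<zeta> - op_fun f X \<zeta>) \<le> C * v"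
      using P_le f_le_v by (simp add: C_def algebra_simps)
    then show ?thesis by (simp add: v_def x_def)
  qed
  have "norm (Z \<zeta> - op_fun f X \<zeta>) \<le> C * norm (X \<zeta> - l *\<^sub>R \<zeta>)"
    if ge: "\<delta> * (norm \<zeta>)\<^sup>2 \<le> inner (X \<zeta>) \<zeta>" for \<zeta> l
  proof (cases "\<zeta> = 0")
    case False
    define \<eta> where "\<eta> = \<zeta> /\<^sub>R norm \<zeta>"
    define x where "x = inner (X \<eta>) \<eta>"
    have \<eta>: "norm \<eta> = 1" "\<zeta> = norm \<zeta> *\<^sub>R \<eta>" using False by (simp_all add: \<eta>_def)
    have "x = inner (X \<zeta>) \<zeta> / (norm \<zeta>)\<^sup>2"
      by (simp add: x_def \<eta>_def blinfun.scaleR_right power2_eq_square divide_inverse)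
    then have "\<delta> \<le> x" using ge False by (simp add: pos_le_divide_eq)
    then have "norm (Z \<eta> - op_fun f X \<eta>) \<le> C * norm (X \<eta> - x *\<^sub>R \<eta>)"
      using unit [OF \<eta>(1)] by (simp add: x_def)
    \<comment> \<open>The mean is the best constant in the least squares sense.\<close>
    also have "norm (X \<eta> - x *\<^sub>R \<eta>) \<le> norm (X \<eta> - l *\<^sub>R \<eta>)"
    proof (rule power2_le_imp_le)
      have "inner \<eta> \<eta> = 1" using \<eta>(1) by (simp add: dot_square_norm)
      then have "(norm (X \<eta> - l *\<^sub>R \<eta>))\<^sup>2 = (norm (X \<eta> - x *\<^sub>R \<eta>))\<^sup>2 + (x - l)\<^sup>2"
        unfolding power2_norm_eq_inner
        by (simp add: inner_diff_left inner_diff_right x_def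
            inner_commute [of \<eta> "X \<eta>"] power2_eq_square algebra_simps)
      then show "(norm (X \<eta> - x *\<^sub>R \<eta>))\<^sup>2 \<le> (norm (X \<eta> - l *\<^sub>R \<eta>))\<^sup>2" by simp
    qed simp
    finally have "norm \<zeta> * norm (Z \<eta> - op_fun f X \<eta>) \<le> norm \<zeta> * (C * norm (X \<eta> - l *\<^sub>R \<eta>))"
      using C by (intro mult_left_mono) (auto simp: mult_left_mono)
    moreover have "norm \<zeta> * norm (Z \<eta> - op_fun f X \<eta>) = norm (Z \<zeta> - op_fun f X \<zeta>)"
    proof -
      have "Z \<zeta> - op_fun f X \<zeta> = norm \<zeta> *\<^sub>R (Z \<eta> - op_fun f X \<eta>)"
        using False by (simp add: \<eta>_def blinfun.scaleR_right scaleR_diff_right)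
      then show ?thesis by simp
    qed
    moreover have "norm \<zeta> * norm (X \<eta> - l *\<^sub>R \<eta>) = norm (X \<zeta> - l *\<^sub>R \<zeta>)"
    proof -
      have "X \<zeta> - l *\<^sub>R \<zeta> = norm \<zeta> *\<^sub>R (X \<eta> - l *\<^sub>R \<eta>)"
        using False by (simp add: \<eta>_def blinfun.scaleR_right scaleR_diff_right)
      then show ?thesis by simp
    qed
    ultimately show ?thesis by (simp add: mult.left_commute)
  qed simp
  with C show ?thesis by blast
qed

text \<open>Cut \<open>\<omega> = \<psi>(X) \<xi>\<close> with \<open>\<psi> t = max 0 (t - \<delta>)\<close> into \<open>n\<close> pieces \<open>w i\<close> whose spectral support has
  width of order \<open>\<epsilon> = R / n\<close>.  Then \<open>\<parallel>D (w i)\<parallel> \<le> C \<epsilon> \<parallel>w i\<parallel>\<close>, and as the squares of the norms of the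
  pieces add up to at most \<open>\<parallel>\<omega>\<parallel>\<^sup>2\<close>, summation costs only a factor \<open>sqrt n\<close>.  Thus \<open>\<parallel>D \<omega>\<parallel>\<close> is of
  order \<open>1 / sqrt n\<close>.  A continuous partition of unity serves in place of spectral projections.\<close>

lemma deviation_zero_above:
  fixes X D :: "'a::complex_hilbert_space \<Rightarrow>\<^sub>L 'a"
  assumes X: "positive_operator X" and C: "C \<ge> 0" and \<delta>: "\<delta> > 0"
    and dev: "\<And>\<zeta> l. \<delta> * (norm \<zeta>)\<^sup>2 \<le> inner (X \<zeta>) \<zeta> \<Longrightarrow> norm (D \<zeta>) \<le> C * norm (X \<zeta> - l *\<^sub>R \<zeta>)"
  shows "D (op_fun (\<lambda>t. max 0 (t - \<delta>)) X \<xi>) = 0"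
proof -
  define \<psi> where "\<psi> t = max 0 (t - \<delta>)" for t
  define R where "R = norm X + 1"
  have R: "R > 0" by (simp add: R_def add_nonneg_pos)
  define \<omega> where "\<omega> = op_fun \<psi> X \<xi>"
  have cont_\<psi>: "continuous_on S \<psi>" for S unfolding \<psi>_def by (intro continuous_intros)
  have bound: "norm (D \<omega>) \<le> C * R * norm \<omega> / sqrt (real n)" if n: "n > 0" "R / real n \<le> \<delta>" for n
  proof -
    define \<epsilon> where "\<epsilon> = R / real n"
    have \<epsilon>: "\<epsilon> > 0" "\<epsilon> \<le> \<delta>" using R n by (simp_all add: \<epsilon>_def)
    \<comment> \<open>\<open>c i\<close> climbs from \<open>0\<close> at \<open>i
      \<epsilon>\<close> to \<open>1\<close> at \<open>(i + 1) \<epsilon>\<close>; the differences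
      \<open>c i - c (i + 1)\<close> are tents that add up by telescoping.\<close>
    define c where "c i t = min 1 (max 0 (t / \<epsilon> - real i))" for i t
    define u where "u i t = (c i t - c (Suc i) t) * \<psi> t" for i t
    have cont: "continuous_on S (u i)" for S i
      unfolding u_def c_def by (intro continuous_intros cont_\<psi>) (use \<epsilon> in auto)
    define w where "w i = op_fun (u i) X \<xi>" for i
    have c01: "0 \<le> c i t - c (Suc i) t" "c i t - c (Suc i) t \<le> 1" for i t
      by (auto simp: c_def min_def max_def)
    have supp: "\<bar>t - (real i + 1) * \<epsilon>\<bar> \<le> \<epsilon>" if "u i t \<noteq> 0" for i t
    proof -
      have "real i \<le> t / \<epsilon>" "t / \<epsilon> \<le> real i + 2"
        using that by (auto simp: u_def c_def min_def max_def split: if_splits)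
      then have "real i * \<epsilon> \<le> t" "t \<le> (real i + 2) * \<epsilon>" using \<epsilon> by (auto simp: field_simps)
      then show ?thesis by (simp add: algebra_simps abs_le_iff)
    qed
    have sum_u: "(\<Sum>i<n. u i t) = \<psi> t" if t: "t \<in> {0..norm X}" for t
    proof -
      have "(\<Sum>i<n. u i t) = (c 0 t - c n t) * \<psi> t"
        unfolding u_def sum_distrib_right [symmetric]
        using sum_lessThan_telescope' [of "\<lambda>i. c i t" n] by simp
      moreover have "t \<le> real n * \<epsilon>" using t n by (simp add: \<epsilon>_def R_def)
      then have "t / \<epsilon> \<le> real n" using \<epsilon> by (simp add: pos_divide_le_eq)
      then have "c n t = 0" by (simp add: c_def)
      moreover have "c 0 t = 1" if "\<psi> t \<noteq> 0"
      proof -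
        have "t \<ge> \<epsilon>" using that \<epsilon> by (auto simp: \<psi>_def max_def split: if_splits)
        then show ?thesis using \<epsilon> by (simp add: c_def field_simps)
      qed
      ultimately show ?thesis by auto
    qed
    have u_sq: "u i t * u i t \<le> u i t * \<psi> t" for i t
    proof -
      have "0 \<le> \<psi> t" by (simp add: \<psi>_def)
      then have "u i t \<le> \<psi> t" "0 \<le> u i t" using c01 [of i t] by (auto simp: u_def mult_le_cancel_right1 mult_right_le_one_le mult_left_le_one_le)
      then show ?thesis by (simp add: mult_left_mono)
    qed
    have w_dev: "norm (D (w i)) \<le> C * \<epsilon> * norm (w i)" for i
    proof -
      define l where "l = (real i + 1) * \<epsilon>"
      have eq: "op_fun (\<lambda>t. (t - s) * u i t) X \<xi> = X (w i) - s *\<^sub>R w i" for s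
        using op_fun_mult [OF X _ cont, of "\<lambda>t. t - s" i]
        by (simp add: op_fun_diff [OF X] op_fun_ident [OF X] op_fun_const [OF X]
            continuous_intros blinfun.diff_left blinfun.scaleR_left w_def)
      have sym: "inner (op_fun (u i) X x) y = inner x (op_fun (u i) X y)" for x y
        by (rule op_fun_symmetric [OF X cont])
      \<comment> \<open>The cutoff \<open>\<psi>\<close> vanishes below \<open>\<delta>\<close>,
        so the mean of \<open>X\<close> in \<open>w i\<close> is at least
        \<open>\<delta>\<close>.\<close>
      have "0 \<le> inner (op_fun (\<lambda>t. u i t * ((t - \<delta>) * u i t)) X \<xi>) \<xi>"
      proof (rule op_fun_nonneg [OF X])
        fix t
        have "0 \<le> (t - \<delta>) * (u i t * u i t)"
          by (cases "t \<ge> \<delta>") (auto simp: u_def \<psi>_def)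
        then show "0 \<le> u i t * ((t - \<delta>) * u i t)" by (simp add: mult_ac)
      qed (intro continuous_intros cont)
      also have "op_fun (\<lambda>t. u i t * ((t - \<delta>) * u i t)) X \<xi> = op_fun (u i) X (X (w i) - \<delta> *\<^sub>R w i)"
        by (subst op_fun_mult [OF X cont]) (intro continuous_intros cont, simp add: eq)
      also have "inner \<dots> \<xi> = inner (X (w i)) (w i) - \<delta> * (norm (w i))\<^sup>2"
        unfolding sym w_def [symmetric] by (simp add: inner_diff_left power2_norm_eq_inner)
      finally have "\<delta> * (norm (w i))\<^sup>2 \<le> inner (X (w i)) (w i)" by simp
      then have "norm (D (w i)) \<le> C * norm (X (w i) - l *\<^sub>R w i)" by (rule dev)
      also have "norm (X (w i) - l *\<^sub>R w i) \<le> norm (op_fun (\<lambda>t. \<epsilon> * u i t) X \<xi>)"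
        unfolding eq [symmetric]
      proof (rule norm_op_fun_mono [OF X])
        fix t show "\<bar>(t - l) * u i t\<bar> \<le> \<bar>\<epsilon> * u i t\<bar>"
          using supp [of i t] \<epsilon> by (cases "u i t = 0") (auto simp: abs_mult l_def mult_right_mono)
      qed (intro continuous_intros cont)+
      also have "\<dots> = \<epsilon> * norm (w i)"
        using \<epsilon> by (simp add: op_fun_cmult [OF X cont] blinfun.scaleR_left w_def)
      finally show ?thesis using C by (simp add: mult_left_mono mult.assoc)
    qed
    have \<omega>: "\<omega> = (\<Sum>i<n. w i)"
    proof -
      have "op_fun \<psi> X = op_fun (\<lambda>t. \<Sum>i<n. u i t) X"
        by (rule op_fun_cong [OF X cont_\<psi>]) (simp add: sum_u)
      then show ?thesis by (simp add: \<omega>_def w_def op_fun_sum [OF X cont] blinfun.sum_left)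
    qed
    have "(\<Sum>i<n. (norm (w i))\<^sup>2) = inner (op_fun (\<lambda>t. \<Sum>i<n. u i t * u i t) X \<xi>) \<xi>"
      unfolding w_def norm_op_fun_power2 [OF X cont]
      by (subst op_fun_sum [OF X]) (intro continuous_intros cont, simp add: blinfun.sum_left inner_sum_left)
    also have "\<dots> \<le> inner (op_fun (\<lambda>t. \<psi> t * \<psi> t) X \<xi>) \<xi>"
    proof (rule op_fun_mono [OF X])
      fix t assume "t \<in> {0..norm X}"
      have "(\<Sum>i<n. u i t * u i t) \<le> (\<Sum>i<n. u i t * \<psi> t)" by (intro sum_mono u_sq)
      also have "\<dots> = \<psi> t * \<psi> t"
        using sum_u \<open>t \<in> {0..norm X}\<close> by (simp flip: sum_distrib_right)
      finally show "(\<Sum>i<n. u i t * u i t) \<le> \<psi> t * \<psi> t" .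
    qed (intro continuous_intros cont cont_\<psi>)+
    also have "\<dots> = (norm \<omega>)\<^sup>2" by (simp add: \<omega>_def norm_op_fun_power2 [OF X cont_\<psi>])
    finally have sq: "(\<Sum>i<n. (norm (w i))\<^sup>2) \<le> (norm \<omega>)\<^sup>2" .
    have sum_w: "(\<Sum>i<n. norm (w i)) \<le> sqrt (real n) * norm \<omega>"
    proof (rule power2_le_imp_le)
      have "(\<Sum>i<n. norm (w i))\<^sup>2 \<le> (\<Sum>i<n. (norm (w i))\<^sup>2) * real n"
        using sum_squared_le_sum_of_squares [of "\<lambda>i. norm (w i)" "{..<n}"] by simp
      also have "\<dots> \<le> (norm \<omega>)\<^sup>2 * real n" using sq by (intro mult_right_mono) auto
      finally show "(\<Sum>i<n. norm (w i))\<^sup>2 \<le> (sqrt (real n) * norm \<omega>)\<^sup>2"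
        by (simp add: power_mult_distrib mult.commute)
    qed simp
    have "norm (D \<omega>) \<le> (\<Sum>i<n. norm (D (w i)))"
      unfolding \<omega> blinfun.sum_right by (rule norm_sum)
    also have "\<dots> \<le> C * \<epsilon> * (\<Sum>i<n. norm (w i))"
      unfolding sum_distrib_left by (intro sum_mono w_dev)
    also have "\<dots> \<le> C * \<epsilon> * (sqrt (real n) * norm \<omega>)"
      using C \<epsilon> sum_w by (intro mult_left_mono) auto
    also have "\<dots> = C * R * norm \<omega> / sqrt (real n)"
      using n by (simp add: \<epsilon>_def field_simps flip: power2_eq_square)
    finally show ?thesis .
  qed
  have "(\<lambda>n. C * R * norm \<omega> / sqrt (real n)) \<longlonglongrightarrow> 0"
    by (intro tendsto_divide_0 [OF tendsto_const] filterlim_at_top_imp_at_infinity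
        filterlim_compose [OF sqrt_at_top filterlim_real_sequentially])
  moreover have "\<forall>\<^sub>F n in sequentially. norm (D \<omega>) \<le> C * R * norm \<omega> / sqrt (real n)"
  proof (rule eventually_sequentiallyI)
    fix n assume n: "n \<ge> nat \<lceil>R / \<delta>\<rceil> + 1"
    then have "R / \<delta> \<le> real n" by linarith
    then have "R / real n \<le> \<delta>" using \<delta> n by (simp add: field_simps)
    with n show "norm (D \<omega>) \<le> C * R * norm \<omega> / sqrt (real n)" by (intro bound) auto
  qed
  ultimately have "norm (D \<omega>) \<le> 0" by (rule tendsto_lowerbound) simp
  then show ?thesis by (simp add: \<omega>_def \<psi>_def [abs_def])
qed

text \<open>For the difference \<open>D = Z - f(X)\<close>, letting \<open>\<delta> \<rightarrow> 0\<close> in \<open>deviation_zero_above\<close> gives \<open>D X = 0\<close>, and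
  by symmetry \<open>X D = 0\<close>, that is, \<open>D\<close> maps into the kernel of \<open>X\<close>.  On this kernel the bounds
  \<open>f 0 \<le> Z\<close> and \<open>\<langle>Z \<eta>, \<eta>\<rangle> \<le> f 0 \<parallel>\<eta>\<parallel>\<^sup>2\<close> leave only \<open>Z \<eta> = f 0 \<eta> = f(X) \<eta>\<close>.  So \<open>D D = 0\<close>, and a
  symmetric operator with square zero vanishes.\<close>

lemma operator_eq_op_fun:
  fixes X Z :: "'a::complex_hilbert_space \<Rightarrow>\<^sub>L 'a" and f g :: "real \<Rightarrow> real"
  assumes f_pos: "\<And>t. t > 0 \<Longrightarrow> 0 < f t" and f0: "0 \<le> f 0"
    and f: "strict_mono_on {0..} f" "concave_on {0..} f" "C2_on {0<..} f" "continuous_on {0..} f"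
    and g: "strict_mono_on {0..} g" "concave_on {0..} g" "C2_on {0<..} g" "continuous_on {0..} g"
    and X: "positive_operator X"
    and sym: "\<And>x y. inner (Z x) y = inner x (Z y)" and Z_ge: "\<And>x. f 0 * (norm x)\<^sup>2 \<le> inner (Z x) x"
    and lower: "\<And>\<xi>. norm \<xi> = 1 \<Longrightarrow> inner (op_fun (g \<circ> f) X \<xi>) \<xi> \<le> g (inner (Z \<xi>) \<xi>)"
    and upper: "\<And>\<xi>. norm \<xi> = 1 \<Longrightarrow> inner (Z \<xi>) \<xi> \<le> f (inner (X \<xi>) \<xi>)"
  shows "Z = op_fun f X"
proof -
  have contf: "continuous_on {0..norm X} f" using f(4) by (rule continuous_on_subset) auto
  define D where "D = Z - op_fun f X"
  have D: "D x = Z x - op_fun f X x" for x by (simp add: D_def blinfun.diff_left)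
  have D_sym: "inner (D x) y = inner x (D y)" for x y
    by (simp add: D inner_diff_left inner_diff_right sym op_fun_symmetric [OF X contf])
  have Z_pos: "0 \<le> inner (Z x) x" for x
    using Z_ge [of x] f0 by (meson mult_nonneg_nonneg order_trans zero_le_power2)
  have f_le: "f s \<le> f t" if "0 \<le> s" "s \<le> t" for s t
    using strict_mono_on_leD [OF f(1)] that by auto
  have DX: "D (X \<xi>) = 0" for \<xi>
  proof -
    have "norm (D (X \<xi>)) \<le> 0 + e" if e: "e > 0" for e
    proof -
      define \<delta> where "\<delta> = e / (norm D * norm \<xi> + 1)"
      have pos: "norm D * norm \<xi> + 1 > 0" by (simp add: add_nonneg_pos)
      then have \<delta>: "\<delta> > 0" using e by (simp add: \<delta>_def)
      obtain C where C: "C \<ge> 0" and dev: "\<And>\<zeta> l. \<delta> * (norm \<zeta>)\<^sup>2 \<le> inner (X \<zeta>) \<zeta> \<Longrightarrow>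
          norm (D \<zeta>) \<le> C * norm (X \<zeta> - l *\<^sub>R \<zeta>)"
        unfolding D using deviation_bound [OF f_pos f0 f g X sym Z_pos lower upper \<delta>] by blast
      let ?\<psi> = "\<lambda>t. max 0 (t - \<delta>)"
      have "D (op_fun ?\<psi> X \<xi>) = 0" by (rule deviation_zero_above [OF X C \<delta> dev])
      then have "D (X \<xi>) = D ((X - op_fun ?\<psi> X) \<xi>)" by (simp add: blinfun.diff_left blinfun.diff_right)
      then have "norm (D (X \<xi>)) \<le> norm D * (norm (X - op_fun ?\<psi> X) * norm \<xi>)"
        by (simp only:) (intro order_trans [OF norm_blinfun] mult_left_mono norm_blinfun norm_ge_zero)
      also have "norm (X - op_fun ?\<psi> X) \<le> \<delta>"
      proof -
        have "norm (op_fun (\<lambda>t. t) X - op_fun ?\<psi> X) \<le> \<delta>"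
          using \<delta> by (intro norm_op_fun_diff_le [OF X] continuous_intros) auto
        then show ?thesis by (simp add: op_fun_ident [OF X])
      qed
      then have "norm D * (norm (X - op_fun ?\<psi> X) * norm \<xi>) \<le> norm D * (\<delta> * norm \<xi>)"
        by (intro mult_left_mono mult_right_mono) auto
      also have "\<dots> = \<delta> * (norm D * norm \<xi>)" by simp
      also have "\<dots> \<le> \<delta> * (norm D * norm \<xi> + 1)" using \<delta> by (intro mult_left_mono) auto
      also have "\<dots> = e" using pos by (simp add: \<delta>_def)
      finally show ?thesis by simp
    qed
    then have "norm (D (X \<xi>)) \<le> 0" by (rule field_le_epsilon)
    then show ?thesis by simp
  qed
  have eigen: "T \<eta> = f 0 *\<^sub>R \<eta>"
    if T_sym: "\<And>x y. inner (T x) y = inner x (T y)" and T_ge: "\<And>x. f 0 * (norm x)\<^sup>2 \<le> inner (T x) x"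
      and T_le: "inner (T \<eta>) \<eta> \<le> f 0 * (norm \<eta>)\<^sup>2" for T :: "'a \<Rightarrow>\<^sub>L 'a" and \<eta>
  proof -
    define P where "P = T - f 0 *\<^sub>R id_blinfun"
    have P: "P x = T x - f 0 *\<^sub>R x" for x by (simp add: P_def blinfun.diff_left blinfun.scaleR_left)
    have "(norm (P \<eta>))\<^sup>2 \<le> norm P * inner (P \<eta>) \<eta>"
      using T_ge by (intro positive_form_Cauchy_Schwarz)
        (auto simp: P inner_diff_left inner_diff_right T_sym dot_square_norm)
    also have "\<dots> \<le> 0"
      using T_le by (intro mult_nonneg_nonpos) (auto simp: P inner_diff_left dot_square_norm)
    finally show ?thesis by (simp add: P)
  qed
  have D_kernel: "D \<eta> = 0" if \<eta>: "X \<eta> = 0" for \<eta>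
  proof -
    have "inner (Z \<eta>) \<eta> \<le> f 0 * (norm \<eta>)\<^sup>2"
    proof (cases "\<eta> = 0")
      case False
      have "inner (Z (\<eta> /\<^sub>R norm \<eta>)) (\<eta> /\<^sub>R norm \<eta>) \<le> f 0"
        using upper [of "\<eta> /\<^sub>R norm \<eta>"] False \<eta> by (simp add: blinfun.scaleR_right)
      then show ?thesis using False by (simp add: blinfun.scaleR_right field_simps power2_eq_square)
    qed simp
    then have "Z \<eta> = f 0 *\<^sub>R \<eta>" by (rule eigen [OF sym Z_ge])
    moreover have "op_fun f X \<eta> = f 0 *\<^sub>R \<eta>"
    proof (rule eigen)
      show "inner (op_fun f X x) y = inner x (op_fun f X y)" for x y by (rule op_fun_symmetric [OF X contf])
      show "f 0 * (norm x)\<^sup>2 \<le> inner (op_fun f X x) x" for x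
        using op_fun_mono [OF X continuous_on_const contf, of "f 0" x] f_le
        by (simp add: op_fun_const [OF X] blinfun.scaleR_left dot_square_norm)
      obtain f' where f': "\<And>t. t > 0 \<Longrightarrow> (f has_real_derivative f' t) (at t)"
        using f(3) unfolding C2_on_def by (auto simp: at_within_open [OF _ open_greaterThan])
      \<comment> \<open>The tangent at \<open>0\<close> may be vertical, so tangents at \<open>s >
        0\<close> are used and \<open>s\<close> tends to \<open>0\<close>.\<close>
      have ev: "inner (op_fun f X \<eta>) \<eta> \<le> f s * (norm \<eta>)\<^sup>2" if s: "s > 0" for s
      proof -
        have "f' s > 0" using concave_slope_bounds(1) [OF f(2) f' [OF s] f(1) s] by blast
        have "inner (op_fun f X \<eta>) \<eta> \<le> inner (op_fun (\<lambda>t. f s + f' s * t) X \<eta>) \<eta>"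
        proof (rule op_fun_mono [OF X contf])
          fix t assume "t \<in> {0..norm X}"
          then have "f t \<le> f s + f' s * (t - s)"
            by (intro concave_on_below_tangent [OF f(2) f' [OF s] s]) auto
          also have "\<dots> \<le> f s + f' s * t" using \<open>f' s > 0\<close> s by (simp add: algebra_simps)
          finally show "f t \<le> f s + f' s * t" .
        qed (intro continuous_intros)
        also have "op_fun (\<lambda>t. f s + f' s * t) X \<eta> = f s *\<^sub>R \<eta>"
          by (simp add: op_fun_add [OF X] op_fun_cmult [OF X] op_fun_ident [OF X] op_fun_const [OF X]
              continuous_intros blinfun.add_left blinfun.scaleR_left \<eta>)
        finally show ?thesis by (simp add: dot_square_norm)
      qed
      have "(f \<longlongrightarrow> f 0) (at 0 within {0..})"
        using f(4) by (auto simp: continuous_on_def)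
      then have "(f \<longlongrightarrow> f 0) (at_right 0)" by (rule tendsto_within_subset) auto
      then have "((\<lambda>s. f s * (norm \<eta>)\<^sup>2) \<longlongrightarrow> f 0 * (norm \<eta>)\<^sup>2) (at_right 0)"
        by (intro tendsto_intros)
      moreover have "\<forall>\<^sub>F s in at_right (0::real). inner (op_fun f X \<eta>) \<eta> \<le> f s * (norm \<eta>)\<^sup>2"
        using eventually_at_right_less [of 0] by eventually_elim (rule ev)
      ultimately show "inner (op_fun f X \<eta>) \<eta> \<le> f 0 * (norm \<eta>)\<^sup>2"
        by (rule tendsto_lowerbound) simp
    qed
    ultimately show ?thesis by (simp add: D)
  qed
  have "D \<xi> = 0" for \<xi>
  proof -
    have "inner (X (D \<xi>)) (X (D \<xi>)) = inner \<xi> (D (X (X (D \<xi>))))"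
      by (simp add: positive_operator_symmetric [OF X] D_sym)
    then have "X (D \<xi>) = 0" by (simp add: DX)
    then have "D (D \<xi>) = 0" by (rule D_kernel)
    then have "inner (D \<xi>) (D \<xi>) = 0" by (simp add: D_sym)
    then show ?thesis by simp
  qed
  then have "D = 0" by (intro blinfun_eqI) simp
  then show ?thesis by (simp add: D_def)
qed

text \<open>The functions \<open>u\<close> with \<open>u(X) = u(Y)\<close> form an algebra that contains \<open>f\<close> and therefore separates
  points.  By the Stone-Weierstrass theorem it is dense, so it comes arbitrarily close to the identity
  function.\<close>

lemma op_fun_inj:
  fixes X Y :: "'a::complex_hilbert_space \<Rightarrow>\<^sub>L 'a" and f :: "real \<Rightarrow> real"
  assumes X: "positive_operator X" and Y: "positive_operator Y"
    and f: "inj_on f {0..}" "continuous_on {0..} f"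
    and eq: "op_fun f X = op_fun f Y"
  shows "X = Y"
proof -
  define S where "S = {0..max (norm X) (norm Y)}"
  have sub: "{0..norm X} \<subseteq> S" "{0..norm Y} \<subseteq> S" "S \<subseteq> {0..}" by (auto simp: S_def)
  note cont = continuous_on_subset [OF _ sub(1)] continuous_on_subset [OF _ sub(2)]
  let ?P = "\<lambda>u. continuous_on S u \<and> op_fun u X = op_fun u Y"
  have "norm (X - Y) \<le> 0 + e" if "e > 0" for e
  proof -
    have "\<exists>u. ?P u \<and> (\<forall>t\<in>S. \<bar>t - u t\<bar> < e / 2)"
    proof (rule Stone_Weierstrass_HOL)
      show "?P (\<lambda>t. c)" for c by (simp add: op_fun_const X Y)
      show "?P (\<lambda>t. u t + v t)" "?P (\<lambda>t. u t * v t)" if "?P u \<and> ?P v" for u v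
        using that cont [of u] cont [of v]
        by (auto simp: op_fun_add [OF X] op_fun_add [OF Y] op_fun_mult [OF X] op_fun_mult [OF Y]
            intro: continuous_intros)
      show "\<exists>u. ?P u \<and> u s \<noteq> u t" if "s \<in> S \<and> t \<in> S \<and> s \<noteq> t" for s t
        using that f eq sub(3) by (intro exI [where x = f]) (auto dest: inj_onD intro: continuous_on_subset)
    qed (use that in \<open>auto simp: S_def intro: continuous_on_id\<close>)
    then obtain u where u: "continuous_on S u" "op_fun u X = op_fun u Y"
      and near: "\<And>t. t \<in> S \<Longrightarrow> \<bar>t - u t\<bar> < e / 2" by blast
    have "norm (A - op_fun u A) \<le> e / 2" if A: "positive_operator A" "{0..norm A} \<subseteq> S" for A :: "'a \<Rightarrow>\<^sub>L 'a"
      using norm_op_fun_diff_le [OF A(1) continuous_on_id continuous_on_subset [OF u(1) A(2)], of "e / 2"]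
        near A \<open>e > 0\<close> by (force simp: op_fun_ident less_imp_le subset_iff)
    then have "norm (X - op_fun u X) \<le> e / 2" "norm (Y - op_fun u X) \<le> e / 2"
      using X Y sub u(2) by metis+
    then show ?thesis
      using norm_triangle_ineq4 [of "X - op_fun u X" "Y - op_fun u X"] by simp
  qed
  then have "norm (X - Y) \<le> 0" by (rule field_le_epsilon)
  then show ?thesis by simp
qed

theorem theorem3p1:
  fixes f g :: "real \<Rightarrow> real"
    and X Y :: "'a::complex_hilbert_space \<Rightarrow>\<^sub>L 'a"
  assumes f_pos: "\<forall>t>0. 0 < f t"
    and f_incr: "strict_mono_on {0..} f"
    and f_concave: "concave_on {0..} f"
    and f_C2: "C2_on {0<..} f"
    and f_cont: "continuous_on {0..} f"
    and g_pos: "\<forall>t>0. 0 < g t"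
    and g_incr: "strict_mono_on {0..} g"
    and g_concave: "concave_on {0..} g"
    and g_C2: "C2_on {0<..} g"
    and g_cont: "continuous_on {0..} g"
    and X_pos: "positive_operator X"
    and Y_pos: "positive_operator Y"
    and ineq: "\<forall>\<xi>. norm \<xi> = 1 \<longrightarrow>
      Re (cinner (blinfun_apply (op_fun (g \<circ> f) X) \<xi>) \<xi>)
        \<le> g (Re (cinner (blinfun_apply (op_fun f Y) \<xi>) \<xi>)) \<and>
      g (Re (cinner (blinfun_apply (op_fun f Y) \<xi>) \<xi>))
        \<le> (g \<circ> f) (Re (cinner (blinfun_apply X \<xi>) \<xi>))"
  shows "X = Y"
proof -
  have f_le: "f s \<le> f t" if "0 \<le> s" "s \<le> t" for s t
    using strict_mono_on_leD [OF f_incr] that by auto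
  have f0: "0 \<le> f 0"
  proof -
    have "(f \<longlongrightarrow> f 0) (at 0 within {0..})"
      using f_cont by (auto simp: continuous_on_def)
    then have "(f \<longlongrightarrow> f 0) (at_right 0)" by (rule tendsto_within_subset) auto
    moreover have "\<forall>\<^sub>F t in at_right (0::real). 0 \<le> f t"
      using eventually_at_right_less [of 0] by eventually_elim (use f_pos in \<open>auto intro: less_imp_le\<close>)
    ultimately show ?thesis by (rule tendsto_lowerbound) simp
  qed
  let ?Z = "op_fun f Y"
  have contf: "continuous_on {0..norm Y} f" using f_cont by (rule continuous_on_subset) auto
  have Z_sym: "inner (?Z x) y = inner x (?Z y)" for x y by (rule op_fun_symmetric [OF Y_pos contf])
  have Z_ge: "f 0 * (norm x)\<^sup>2 \<le> inner (?Z x) x" for x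
    using op_fun_mono [OF Y_pos continuous_on_const contf, of "f 0" x] f_le
    by (simp add: op_fun_const [OF Y_pos] blinfun.scaleR_left dot_square_norm)
  have lower: "inner (op_fun (g \<circ> f) X \<xi>) \<xi> \<le> g (inner (?Z \<xi>) \<xi>)" if "norm \<xi> = 1" for \<xi>
    using ineq that by (simp add: inner_eq_Re_cinner)
  have upper: "inner (?Z \<xi>) \<xi> \<le> f (inner (X \<xi>) \<xi>)" if "norm \<xi> = 1" for \<xi>
  proof -
    have "g (inner (?Z \<xi>) \<xi>) \<le> g (f (inner (X \<xi>) \<xi>))"
      using ineq that by (simp add: inner_eq_Re_cinner)
    moreover have "0 \<le> inner (?Z \<xi>) \<xi>" using Z_ge [of \<xi>] f0 that by simp
    moreover have "0 \<le> f (inner (X \<xi>) \<xi>)"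
      using f_le [OF order_refl positive_operator_inner_nonneg [OF X_pos]] f0 by (meson order_trans)
    ultimately show ?thesis using strict_mono_on_less_eq [OF g_incr] by auto
  qed
  have "?Z = op_fun f X"
    using f_pos by (intro operator_eq_op_fun [OF _ f0 f_incr f_concave f_C2 f_cont g_incr g_concave g_C2 g_cont
          X_pos Z_sym Z_ge lower upper]) auto
  then show ?thesis
    by (intro op_fun_inj [OF X_pos Y_pos strict_mono_on_imp_inj_on [OF f_incr] f_cont]) simp
qed

end
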